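(* Let $G$ be a finite group which is a direct product of elementary abelian groups, let $\mathcal{A}$ be an $S$-ring over $G$, and let $S=U/L$ be an $\mathcal{A}$-section of $G$. Suppose that $\mathcal{A}$ is the nontrivial $S$-wreath product (i.e. $L\neq\{e\}$ and $U\neq G$), and that the $S$-rings $\mathcal{A}_U$ and $\mathcal{A}_{G/L}$ are $CI$-$S$-rings. If $$\mathrm{Aut}_{S}(\mathcal{A}_{S})=\mathrm{Aut}_U(\mathcal{A}_U)^{S}\,\mathrm{Aut}_{G/L}(\mathcal{A}_{G/L})^{S},$$ then $\mathcal{A}$ is a $CI$-$S$-ring. In particular, $\mathcal{A}$ is a $CI$-$S$-ring if $\mathrm{Aut}_{S}(\mathcal{A}_{S})=\mathrm{Aut}_U(\mathcal{A}_U)^{S}$ or $\mathrm{Aut}_{S}(\mathcal{A}_{S})=\mathrm{Aut}_{G/L}(\mathcal{A}_{G/L})^{S}$.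
   Context: For a finite group $G$ with identity $e$ and $X\subseteq G$, write $\underline{X}=\sum_{x\in X}x\in\mathbb{Z}G$ and $X^{-1}=\{x^{-1}:x\in X\}$. An $S$-ring over $G$ is a subring $\mathcal{A}\subseteq\mathbb{Z}G$ for which there is a partition $\mathcal{S}(\mathcal{A})$ of $G$ (the basic sets) with $\{e\}\in\mathcal{S}(\mathcal{A})$, $X^{-1}\in\mathcal{S}(\mathcal{A})$ whenever $X\in\mathcal{S}(\mathcal{A})$, and $\mathcal{A}=\mathrm{Span}_{\mathbb{Z}}\{\underline{X}:X\in\mathcal{S}(\mathcal{A})\}$. A subgroup $H\le G$ is an $\mathcal{A}$-subgroup if $\underline{H}\in\mathcal{A}$. If $L\trianglelefteq U\le G$ are $\mathcal{A}$-subgroups, $U/L$ is an $\mathcal{A}$-section, and the quotient $S$-ring $\mathcal{A}_{U/L}$ over $U/L$ is the span of the images $\pi(X)$ (as elements of $\mathbb{Z}(U/L)$) of basic sets $X\subseteq U$ under the canonical epimorphism $\pi:U\to U/L$; its basic sets are the sets $\pi(X)$. We write $\mathcal{A}_U=\mathcal{A}_{U/\{e\}}$ and $\mathcal{A}_{G/L}=\mathcal{A}_{G/L}$ for an $\mathcal{A}$-subgroup $L\trianglelefteq G$. The radical of $X\subseteq G$ is $\mathrm{rad}(X)=\{g\in G: gX=Xg=X\}$. For an $\mathcal{A}$-section $S=U/L$, $\mathcal{A}$ is the $S$-wreath product if $L\trianglelefteq G$ and $L\le\mathrm{rad}(X)$ for every basic set $X$ not contained in $U$; it is nontrivial if $L\ne\{e\}$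 and $U\ne G$. For $X\in\mathcal{S}(\mathcal{A})$ let $R(X)=\{(g,xg):g\in G,x\in X\}$. An isomorphism from $\mathcal{A}$ to an $S$-ring $\mathcal{A}'$ over $G'$ is a bijection $f:G\to G'$ with $\{R(X)^f:X\in\mathcal{S}(\mathcal{A})\}=\{R(X'):X'\in\mathcal{S}(\mathcal{A}')\}$, where $R^f=\{(g^f,h^f):(g,h)\in R\}$. $\mathrm{Aut}(\mathcal{A})$ is the group of bijections $f$ of $G$ with $R(X)^f=R(X)$ for all $X\in\mathcal{S}(\mathcal{A})$; $\mathrm{Aut}_G(\mathcal{A})=\mathrm{Aut}(\mathcal{A})\cap\mathrm{Aut}(G)$ (group automorphisms $f$ of $G$ with $X^f=X$ for all basic sets $X$). $\mathrm{Iso}(\mathcal{A})$ is the set of permutations of $G$ that are isomorphisms from $\mathcal{A}$ onto some $S$-ring over $G$. $\mathcal{A}$ is a $CI$-$S$-ring if $\mathrm{Iso}(\mathcal{A})=\mathrm{Aut}(\mathcal{A})\mathrm{Aut}(G)$. For a set $\Delta$ of permutations of a group $H$ and a section $S=U/L$ of $H$, $\Delta^S=\{f^S: f\in\Delta,\ S^f=S\}$, where $S^f=S$ means $f$ maps $U$ onto itself and permutes the $L$-cosets in $U$, and $f^S$ is the induced bijection of $S$. Here $\mathrm{Aut}_U(\mathcal{A}_U)^S$ and $\mathrm{Aut}_{G/L}(\mathcal{A}_{G/L})^S$ are taken with $S$ viewed as the section $U/L$ of $U$ and as the subgroup $U/L$ (section $(U/L)/\{L\}$) of $G/L$, respectively.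 *)

theory Defs
  imports
    "HOL-Algebra.Subrings"
    "HOL-Algebra.Bij"
    "HOL-Algebra.Product_Groups"
    "HOL-Computational_Algebra.Primes"
    "HOL-Library.Disjoint_Sets"
    "HOL-Library.Indicator_Function"
begin

definition elementary_abelian :: "('a, 'm) monoid_scheme \<Rightarrow> bool"
  where "elementary_abelian E \<longleftrightarrow>
    comm_group E \<and>
    (\<exists>p::nat. prime p \<and> (\<forall>x\<in>carrier E. x [^]\<^bsub>E\<^esub> p = \<one>\<^bsub>E\<^esub>))"

text \<open>
  An element of the group ring is its coefficient function, extended by zero outside the group.
  Finiteness of the group is assumed throughout: the sums below are not meaningful without it.
\<close>

definition group_ring :: "('a, 'm) monoid_scheme \<Rightarrow> ('a \<Rightarrow> int) ring"
  where "group_ring G =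
    \<lparr>carrier = {a. \<forall>g. g \<notin> carrier G \<longrightarrow> a g = 0},
     monoid.mult = (\<lambda>a b g. \<Sum>(h, k) \<in> {(h, k) \<in> carrier G \<times> carrier G. h \<otimes>\<^bsub>G\<^esub> k = g}. a h * b k),
     one = indicator {\<one>\<^bsub>G\<^esub>},
     zero = (\<lambda>g. 0),
     add = (\<lambda>a b g. a g + b g)\<rparr>"

definition underl :: "'a set \<Rightarrow> 'a \<Rightarrow> int"
  where "underl X = indicator X"

definition int_span :: "'a set set \<Rightarrow> ('a \<Rightarrow> int) set"
  where "int_span P = {(\<lambda>g. \<Sum>X\<in>P. c X * underl X g) | c. True}"

definition basic_partition ::
    "('a, 'm) monoid_scheme \<Rightarrow> ('a \<Rightarrow> int) set \<Rightarrow> 'a set set \<Rightarrow> bool"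
  where "basic_partition G A P \<longleftrightarrow>
    partition_on (carrier G) P \<and>
    {\<one>\<^bsub>G\<^esub>} \<in> P \<and>
    (\<forall>X\<in>P. m_inv G ` X \<in> P) \<and>
    A = int_span P"

definition s_ring :: "('a, 'm) monoid_scheme \<Rightarrow> ('a \<Rightarrow> int) set \<Rightarrow> bool"
  where "s_ring G A \<longleftrightarrow> subring A (group_ring G) \<and> (\<exists>P. basic_partition G A P)"

definition basic_sets :: "('a, 'm) monoid_scheme \<Rightarrow> ('a \<Rightarrow> int) set \<Rightarrow> 'a set set"
  where "basic_sets G A = (THE P. basic_partition G A P)"

lemma int_span_block_const:
  assumes P: "partition_on C P" and a: "a \<in> int_span P"
    and Y: "Y \<in> P" "x \<in> Y" "y \<in> Y"
  shows "a x = a y"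
proof -
  from a obtain c where c: "a = (\<lambda>g. \<Sum>X\<in>P. c X * underl X g)"
    by (auto simp: int_span_def)
  have "underl X x = underl X y" if "X \<in> P" for X
  proof -
    have "x \<in> X \<longleftrightarrow> X = Y" "y \<in> X \<longleftrightarrow> X = Y"
      using P Y that by (auto simp: partition_on_def disjoint_def)
    then show ?thesis
      by (simp add: underl_def indicator_def)
  qed
  then show ?thesis
    unfolding c by (intro sum.cong) auto
qed

lemma underl_in_int_span:
  assumes "finite P" "X \<in> P"
  shows "underl X \<in> int_span P"
proof -
  have "underl X = (\<lambda>g. \<Sum>Y\<in>P. (if Y = X then 1 else 0) * underl Y g)"
  proof
    fix g
    have "(\<Sum>Y\<in>P. (if Y = X then 1 else 0) * underl Y g) = (\<Sum>Y\<in>P. if Y = X then underl Y g else 0)"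
      by (rule sum.cong) auto
    then show "underl X g = (\<Sum>Y\<in>P. (if Y = X then 1 else 0) * underl Y g)"
      using assms by (simp add: sum.delta)
  qed
  then show ?thesis
    unfolding int_span_def by (intro CollectI exI[of _ "\<lambda>Y. if Y = X then 1 else 0"]) simp
qed

lemma int_span_eq_subset:
  assumes fin: "finite C" and P: "partition_on C P" and Q: "partition_on C Q"
    and eq: "int_span P = int_span Q"
  shows "P \<subseteq> Q"
proof
  have finP: "finite P" and finQ: "finite Q"
    using finite_elements[OF fin P] finite_elements[OF fin Q] .
  fix X assume X: "X \<in> P"
  then have "X \<noteq> {}" "X \<subseteq> C"
    using P by (auto simp: partition_on_def)
  then obtain x where x: "x \<in> X" "x \<in> C"
    by blast
  then obtain Y where Y: "Y \<in> Q" "x \<in> Y"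
    using Q unfolding partition_on_def by blast
  have "underl X \<in> int_span Q"
    using underl_in_int_span[OF finP X] eq by simp
  from int_span_block_const[OF Q this Y(1) _ Y(2)] have "Y \<subseteq> X"
    using x by (auto simp: underl_def indicator_eq_1_iff)
  have "underl Y \<in> int_span P"
    using underl_in_int_span[OF finQ Y(1)] eq by simp
  from int_span_block_const[OF P this X _ x(1)] have "X \<subseteq> Y"
    using Y by (auto simp: underl_def indicator_eq_1_iff)
  with \<open>Y \<subseteq> X\<close> Y show "X \<in> Q"
    by simp
qed

lemma basic_partition_unique:
  assumes "finite (carrier G)" "basic_partition G A P" "basic_partition G A Q"
  shows "P = Q"
proof (rule subset_antisym)
  have part: "partition_on (carrier G) P" "partition_on (carrier G) Q"
    and eq: "int_span P = int_span Q"
    using assms by (simp_all add: basic_partition_def)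
  show "P \<subseteq> Q"
    by (rule int_span_eq_subset[OF assms(1) part eq])
  show "Q \<subseteq> P"
    by (rule int_span_eq_subset[OF assms(1) part(2,1) eq[symmetric]])
qed

lemma basic_sets_eq:
  assumes "finite (carrier G)" "basic_partition G A P"
  shows "basic_sets G A = P"
  unfolding basic_sets_def
proof (rule the_equality)
  show "basic_partition G A P"
    by (rule assms(2))
  show "Q = P" if "basic_partition G A Q" for Q
    by (rule basic_partition_unique[OF assms(1) that assms(2)])
qed

definition a_subgroup :: "('a, 'm) monoid_scheme \<Rightarrow> ('a \<Rightarrow> int) set \<Rightarrow> 'a set \<Rightarrow> bool"
  where "a_subgroup G A H \<longleftrightarrow> subgroup H G \<and> underl H \<in> A"

definition a_section ::
    "('a, 'm) monoid_scheme \<Rightarrow> ('a \<Rightarrow> int) set \<Rightarrow> 'a set \<Rightarrow> 'a set \<Rightarrow> bool"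
  where "a_section G A U L \<longleftrightarrow>
    a_subgroup G A U \<and> a_subgroup G A L \<and> L \<lhd> G\<lparr>carrier := U\<rparr>"

definition section_group ::
    "('a, 'm) monoid_scheme \<Rightarrow> 'a set \<Rightarrow> 'a set \<Rightarrow> 'a set monoid"
  where "section_group G U L = G\<lparr>carrier := U\<rparr> Mod L"

text \<open>
  The quotient S-ring is an S-ring over \<^term>\<open>section_group G U L\<close>; for \<^term>\<open>U = carrier G\<close>
  this group is \<^term>\<open>G Mod L\<close>.
\<close>

definition quotient_sring ::
    "('a, 'm) monoid_scheme \<Rightarrow> ('a \<Rightarrow> int) set \<Rightarrow> 'a set \<Rightarrow> 'a set \<Rightarrow> ('a set \<Rightarrow> int) set"
  where "quotient_sring G A U L =
    int_span {(\<lambda>x. L #>\<^bsub>G\<^esub> x) ` X | X. X \<in> basic_sets G A \<and> X \<subseteq> U}"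

text \<open>
  The S-ring induced on a subgroup \<open>U\<close> is the quotient for \<open>L = {\<one>}\<close>, with each coset \<open>{u}\<close>
  identified with \<open>u\<close>, so that it lives over \<^term>\<open>G\<lparr>carrier := U\<rparr>\<close>.
\<close>

definition sub_sring ::
    "('a, 'm) monoid_scheme \<Rightarrow> ('a \<Rightarrow> int) set \<Rightarrow> 'a set \<Rightarrow> ('a \<Rightarrow> int) set"
  where "sub_sring G A U = int_span {X. X \<in> basic_sets G A \<and> X \<subseteq> U}"

definition rad :: "('a, 'm) monoid_scheme \<Rightarrow> 'a set \<Rightarrow> 'a set"
  where "rad G X = {g \<in> carrier G. g <#\<^bsub>G\<^esub> X = X \<and> X #>\<^bsub>G\<^esub> g = X}"

definition wreath_product ::
    "('a, 'm) monoid_scheme \<Rightarrow> ('a \<Rightarrow> int) set \<Rightarrow> 'a set \<Rightarrow> 'a set \<Rightarrow> bool"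
  where "wreath_product G A U L \<longleftrightarrow>
    a_section G A U L \<and> L \<lhd> G \<and>
    (\<forall>X\<in>basic_sets G A. \<not> X \<subseteq> U \<longrightarrow> L \<subseteq> rad G X)"

definition nontrivial_wreath_product ::
    "('a, 'm) monoid_scheme \<Rightarrow> ('a \<Rightarrow> int) set \<Rightarrow> 'a set \<Rightarrow> 'a set \<Rightarrow> bool"
  where "nontrivial_wreath_product G A U L \<longleftrightarrow>
    wreath_product G A U L \<and> L \<noteq> {\<one>\<^bsub>G\<^esub>} \<and> U \<noteq> carrier G"

definition Rel :: "('a, 'm) monoid_scheme \<Rightarrow> 'a set \<Rightarrow> ('a \<times> 'a) set"
  where "Rel G X = {(g, x \<otimes>\<^bsub>G\<^esub> g) | g x. g \<in> carrier G \<and> x \<in> X}"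

definition rel_image :: "('a \<Rightarrow> 'b) \<Rightarrow> ('a \<times> 'a) set \<Rightarrow> ('b \<times> 'b) set"
  where "rel_image f R = {(f g, f h) | g h. (g, h) \<in> R}"

definition sring_iso ::
    "('a, 'm) monoid_scheme \<Rightarrow> ('a \<Rightarrow> int) set \<Rightarrow>
     ('b, 'n) monoid_scheme \<Rightarrow> ('b \<Rightarrow> int) set \<Rightarrow> ('a \<Rightarrow> 'b) \<Rightarrow> bool"
  where "sring_iso G A G' A' f \<longleftrightarrow>
    bij_betw f (carrier G) (carrier G') \<and>
    {rel_image f (Rel G X) | X. X \<in> basic_sets G A} = {Rel G' X' | X'. X' \<in> basic_sets G' A'}"

definition Aut_sring :: "('a, 'm) monoid_scheme \<Rightarrow> ('a \<Rightarrow> int) set \<Rightarrow> ('a \<Rightarrow> 'a) set"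
  where "Aut_sring G A =
    {f \<in> Bij (carrier G). \<forall>X\<in>basic_sets G A. rel_image f (Rel G X) = Rel G X}"

definition Aut_grp_sring :: "('a, 'm) monoid_scheme \<Rightarrow> ('a \<Rightarrow> int) set \<Rightarrow> ('a \<Rightarrow> 'a) set"
  where "Aut_grp_sring G A = Aut_sring G A \<inter> auto G"

definition Iso_sring :: "('a, 'm) monoid_scheme \<Rightarrow> ('a \<Rightarrow> int) set \<Rightarrow> ('a \<Rightarrow> 'a) set"
  where "Iso_sring G A =
    {f \<in> Bij (carrier G). \<exists>A'. s_ring G A' \<and> sring_iso G A G A' f}"

text \<open>
  Permutations act on the right, so in a product of two sets of permutations of \<open>C\<close> the factor
  from the left-hand set is applied first.
\<close>

definition perm_prod :: "'a set \<Rightarrow> ('a \<Rightarrow> 'a) set \<Rightarrow> ('a \<Rightarrow> 'a) set \<Rightarrow> ('a \<Rightarrow> 'a) set"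
  where "perm_prod C \<Delta> \<Gamma> = {compose C g f | f g. f \<in> \<Delta> \<and> g \<in> \<Gamma>}"

definition ci_sring :: "('a, 'm) monoid_scheme \<Rightarrow> ('a \<Rightarrow> int) set \<Rightarrow> bool"
  where "ci_sring G A \<longleftrightarrow> Iso_sring G A = perm_prod (carrier G) (Aut_sring G A) (auto G)"

definition section_perms ::
    "('a, 'm) monoid_scheme \<Rightarrow> 'a set \<Rightarrow> 'a set \<Rightarrow> ('a \<Rightarrow> 'a) set \<Rightarrow> ('a set \<Rightarrow> 'a set) set"
  where "section_perms H U L \<Delta> =
    {(\<lambda>C\<in>carrier (section_group H U L). f ` C) | f.
       f \<in> \<Delta> \<and> f ` U = U \<and>
       (\<lambda>C. f ` C) ` carrier (section_group H U L) = carrier (section_group H U L)}"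

text \<open>
  The case of a subgroup \<open>V\<close>, viewed as the section of \<open>V\<close> by the trivial subgroup, again with
  \<open>{v}\<close> identified with \<open>v\<close>: the induced map is the restriction to \<open>V\<close>.
\<close>

definition subgroup_perms :: "'a set \<Rightarrow> ('a \<Rightarrow> 'a) set \<Rightarrow> ('a \<Rightarrow> 'a) set"
  where "subgroup_perms V \<Delta> = {restrict f V | f. f \<in> \<Delta> \<and> f ` V = V}"

end

theory Submission
  imports Defs "HOL-Algebra.Sylow"
begin

text \<open>
  Since right translations lie in \<open>Aut(A)\<close>, the S-ring \<open>A\<close> is CI iff every isomorphism \<open>f\<close> from
  \<open>A\<close> that fixes the identity acts on the basic sets of \<open>A\<close> as some automorphism of \<open>G\<close>. Such an
  \<open>f\<close> maps \<open>L \<le> U\<close> to a flag of subgroups of the same orders, and as \<open>G\<close> is abelian of squarefree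
  exponent (so subgroups are complemented and determined up to isomorphism by their order) an
  automorphism of \<open>G\<close> moves this flag back; hence one may assume that \<open>f\<close> fixes \<open>U\<close> and \<open>L\<close>. By the
  CI hypotheses \<open>f\<close> acts on the basic sets inside \<open>U\<close> as some \<open>\<sigma>1\<close> in \<open>Aut(U)\<close> and on those of
  \<open>G/L\<close> as some \<open>\<sigma>2\<close> in \<open>Aut(G/L)\<close>. On \<open>U/L\<close> the two differ by an element of \<open>Aut\<^sub>S(A\<^sub>S)\<close>, whose
  factorization allows one to correct \<open>\<sigma>1\<close> and \<open>\<sigma>2\<close> until they agree there. They then glue to an
  automorphism of \<open>G\<close>, because \<open>U\<close> and \<open>L\<close> are complemented. It acts as \<open>f\<close> on the basic sets inside
  \<open>U\<close>, and also on the remaining ones, which are unions of \<open>L\<close>-cosets.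
\<close>

section \<open>Abelian groups of squarefree exponent\<close>

text \<open>The obstacle is that \<open>f\<close> need not be a homomorphism: it only respects the
  relations "\<open>h g^-1\<close> lies in \<open>X\<close>". No pointwise comparison with
  automorphisms is available, so every comparison is between images of basic sets. What survives is
  that \<open>f\<close> maps a subgroup that is a union of basic sets onto a subgroup, and its
  cosets onto cosets; this is how \<open>f\<close> acts on \<open>U\<close> and on
  \<open>G/L\<close>. With maps composed from right to left, the discrepancy on \<open>U/L\<close>
  is \<open>\<rho> = \<sigma>2^-1 \<sigma>1\<close>. If it is induced by
  \<open>\<tau>2 \<tau>1\<close>, then \<open>\<sigma>1 \<tau>1^-1\<close> and
  \<open>\<sigma>2 \<tau>2\<close> agree on \<open>U/L\<close>. Both corrections fix every basic set
  concerned, so what is known about the action on basic sets is kept. Gluing needs two complements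
  for different reasons: one of \<open>U\<close>, so that a map on \<open>U\<close> can be extended
  at all, and one of \<open>L\<close>, so that a map into \<open>G/L\<close> can be lifted to
  \<open>G\<close> multiplicatively. For a basic set outside \<open>U\<close> agreement modulo
  \<open>L\<close> suffices, since \<open>f\<close> and the glued automorphism both permute the
  cosets of \<open>L\<close>.\<close>

lemma set_mult_memI: "h \<in> H \<Longrightarrow> k \<in> K \<Longrightarrow> h \<otimes>\<^bsub>G\<^esub> k \<in> H <#>\<^bsub>G\<^esub> K"
  by (auto simp: set_mult_def)

lemma (in monoid) subset_set_mult_right:
  assumes "\<one> \<in> H" "K \<subseteq> carrier G"
  shows "K \<subseteq> H <#> K"
proof
  fix k assume "k \<in> K"
  then show "k \<in> H <#> K"
    using set_mult_memI[OF assms(1), of k K G] assms(2) by auto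
qed

lemma (in monoid) subset_set_mult_left:
  assumes "\<one> \<in> K" "H \<subseteq> carrier G"
  shows "H \<subseteq> H <#> K"
proof
  fix h assume "h \<in> H"
  then show "h \<in> H <#> K"
    using set_mult_memI[OF _ assms(1), of h H G] assms(2) by auto
qed

text \<open>The element \<open>h'^-1 h = k' k^-1\<close> lies in both subgroups, hence is
  trivial.\<close>

lemma (in comm_group) complement_decomposition_unique:
  assumes H: "subgroup H G" and K: "subgroup K G" and HK: "H \<inter> K = {\<one>}"
    and hk: "h \<in> H" "h' \<in> H" "k \<in> K" "k' \<in> K" "h \<otimes> k = h' \<otimes> k'"
  shows "h = h' \<and> k = k'"
proof -
  interpret H: subgroup H G by (rule H)
  interpret K: subgroup K G by (rule K)
  have car: "h \<in> carrier G" "h' \<in> carrier G" "k \<in> carrier G" "k' \<in> carrier G"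
    using hk H.subset K.subset by auto
  have "inv h' \<otimes> h = inv h' \<otimes> (h \<otimes> k) \<otimes> inv k"
    using car by (simp add: m_assoc)
  also have "\<dots> = k' \<otimes> inv k"
    using car unfolding hk(5) by (simp add: m_assoc[symmetric])
  finally have eq: "inv h' \<otimes> h = k' \<otimes> inv k" .
  have "inv h' \<otimes> h \<in> H" "k' \<otimes> inv k \<in> K"
    using hk by auto
  then have one: "inv h' \<otimes> h = \<one>" "k' \<otimes> inv k = \<one>"
    using HK eq by auto
  have "h = h' \<otimes> (inv h' \<otimes> h)" "k' = (k' \<otimes> inv k) \<otimes> k"
    using car by (simp_all add: m_assoc[symmetric], simp add: m_assoc)
  then show ?thesis
    using car unfolding one by simp
qed

text \<open>Uniqueness of the decomposition makes the pointwise product of the two maps well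
  defined, and commutativity of \<open>M\<close> makes it multiplicative.\<close>

lemma (in comm_group) hom_glue_complements:
  assumes H: "subgroup H G" and K: "subgroup K G" and HK: "H \<inter> K = {\<one>}"
    and M: "comm_group M"
    and \<phi>: "\<phi> \<in> hom (G\<lparr>carrier := H\<rparr>) M" and \<psi>: "\<psi> \<in> hom (G\<lparr>carrier := K\<rparr>) M"
  obtains \<theta> where "\<theta> \<in> hom (G\<lparr>carrier := H <#> K\<rparr>) M"
    and "\<And>h k. h \<in> H \<Longrightarrow> k \<in> K \<Longrightarrow> \<theta> (h \<otimes> k) = \<phi> h \<otimes>\<^bsub>M\<^esub> \<psi> k"
proof -
  interpret M: comm_group M by (rule M)
  interpret H: subgroup H G by (rule H)
  interpret K: subgroup K G by (rule K)
  \<comment> \<open>Some decomposition of \<open>x\<close> is chosen; by uniqueness it is the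
    expected one.\<close>
  define \<theta> where "\<theta> x = (let p = SOME p. fst p \<in> H \<and> snd p \<in> K \<and> x = fst p \<otimes> snd p
     in \<phi> (fst p) \<otimes>\<^bsub>M\<^esub> \<psi> (snd p))" for x
  have \<theta>: "\<theta> (h \<otimes> k) = \<phi> h \<otimes>\<^bsub>M\<^esub> \<psi> k" if hk: "h \<in> H" "k \<in> K" for h k
  proof -
    let ?Q = "\<lambda>p. fst p \<in> H \<and> snd p \<in> K \<and> h \<otimes> k = fst p \<otimes> snd p"
    have "?Q (h, k)" using hk by simp
    then have "?Q (SOME p. ?Q p)" by (rule someI)
    then have "h = fst (SOME p. ?Q p) \<and> k = snd (SOME p. ?Q p)"
      using hk by (intro complement_decomposition_unique[OF H K HK]) auto
    then show ?thesis
      unfolding \<theta>_def by (simp add: Let_def)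
  qed
  have "\<theta> \<in> hom (G\<lparr>carrier := H <#> K\<rparr>) M"
  proof (rule homI)
    fix x assume "x \<in> carrier (G\<lparr>carrier := H <#> K\<rparr>)"
    then obtain h k where "h \<in> H" "k \<in> K" "x = h \<otimes> k"
      by (auto simp: set_mult_def)
    then show "\<theta> x \<in> carrier M"
      using \<phi> \<psi> by (auto simp: \<theta> hom_def Pi_iff)
  next
    fix x y assume "x \<in> carrier (G\<lparr>carrier := H <#> K\<rparr>)" "y \<in> carrier (G\<lparr>carrier := H <#> K\<rparr>)"
    then obtain h k h' k' where *: "h \<in> H" "k \<in> K" "x = h \<otimes> k" "h' \<in> H" "k' \<in> K" "y = h' \<otimes> k'"
      by (auto simp: set_mult_def)
    then have "x \<otimes> y = (h \<otimes> h') \<otimes> (k \<otimes> k')"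
      using H.subset K.subset by (simp add: m_ac subset_iff)
    moreover have "\<phi> (h \<otimes> h') = \<phi> h \<otimes>\<^bsub>M\<^esub> \<phi> h'" "\<psi> (k \<otimes> k') = \<psi> k \<otimes>\<^bsub>M\<^esub> \<psi> k'"
      "\<phi> h \<in> carrier M" "\<phi> h' \<in> carrier M" "\<psi> k \<in> carrier M" "\<psi> k' \<in> carrier M"
      using \<phi> \<psi> * by (auto simp: hom_def Pi_iff)
    ultimately show "\<theta> (x \<otimes>\<^bsub>G\<lparr>carrier := H <#> K\<rparr>\<^esub> y) = \<theta> x \<otimes>\<^bsub>M\<^esub> \<theta> y"
      using * by (simp add: \<theta> M.m_ac)
  qed
  with \<theta> show thesis
    using that by blast
qed

lemma (in comm_group) card_set_mult_complements:
  assumes "subgroup H G" "subgroup K G" "H \<inter> K = {\<one>}"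
  shows "card (H <#> K) = card H * card K"
proof -
  have "inj_on (\<lambda>(h, k). h \<otimes> k) (H \<times> K)"
    using complement_decomposition_unique[OF assms] by (intro inj_onI) auto
  moreover have "(\<lambda>(h, k). h \<otimes> k) ` (H \<times> K) = H <#> K"
    by (auto simp: set_mult_def)
  ultimately show ?thesis
    by (metis card_cartesian_product card_image)
qed

text \<open>
  A finite group is a direct product of elementary abelian groups iff it is abelian of squarefree
  exponent; a squarefree number is represented by its set of prime divisors.
\<close>

locale squarefree_exponent_group = comm_group G for G (structure) +
  fixes Q :: "nat set"
  assumes finite_carrier: "finite (carrier G)"
    and finite_primes: "finite Q"
    and primes: "\<And>p. p \<in> Q \<Longrightarrow> prime p"
    and exponent: "\<And>x. x \<in> carrier G \<Longrightarrow> x [^] \<Prod>Q = \<one>"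
begin

text \<open>Primes are peeled off a squarefree number annihilating an element outside
  \<open>W\<close>. If \<open>x [^] p\<close> is still outside \<open>W\<close>, the product
  \<open>m\<close> of the remaining primes annihilates it and the induction continues; otherwise
  \<open>x [^] m\<close> lies outside \<open>W\<close> and its \<open>p\<close>-th power is
  trivial.\<close>

lemma prime_order_element_outside:
  assumes W: "subgroup W G" and x: "x \<in> carrier G" "x \<notin> W"
  shows "\<exists>p y. prime p \<and> y \<in> carrier G \<and> y \<notin> W \<and> y [^] (p::nat) = \<one>"
proof -
  interpret W: subgroup W G by (rule W)
  have "\<exists>p y. prime p \<and> y \<in> carrier G \<and> y \<notin> W \<and> y [^] (p::nat) = \<one>"
    if "finite R" "R \<subseteq> Q" "x \<in> carrier G" "x \<notin> W" "x [^] \<Prod>R = \<one>" for R x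
    using that
  proof (induction R arbitrary: x rule: finite_induct)
    case empty
    then show ?case using W.one_closed by simp
  next
    case (insert p R)
    let ?m = "\<Prod>R"
    have p: "prime p" using insert primes by auto
    have cop: "coprime p ?m"
      using insert primes by (intro prod_coprime_right) (auto intro!: primes_coprime)
    show ?case
    proof (cases "x [^] p \<in> W")
      case False
      have "(x [^] p) [^] ?m = \<one>"
        using insert by (simp add: nat_pow_pow)
      with False insert show ?thesis
        by (intro insert.IH[of "x [^] p"]) auto
    next
      case True
      \<comment> \<open>Squarefreeness enters here: \<open>p\<close> and \<open>?m\<close> are
        coprime, so by Bezout \<open>x\<close> is a product of powers of \<open>x [^] p\<close> and
        \<open>x [^] ?m\<close>, which cannot both lie in \<open>W\<close>.\<close>
      have "x [^] ?m \<notin> W"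
      proof
        assume m: "x [^] ?m \<in> W"
        obtain u v :: int where uv: "u * int p + v * int ?m = 1"
          using cop bezout_int[of "int p" "int ?m"]
          by (auto simp: coprime_iff_gcd_eq_1 gcd_int_int_eq simp del: of_nat_prod)
        have "x = x [^] (u * int p + v * int ?m)"
          using uv insert.prems by simp
        also have "\<dots> = (x [^] p) [^] u \<otimes> (x [^] ?m) [^] v"
          using insert.prems
          by (simp add: int_pow_mult int_pow_pow int_pow_int[symmetric] mult.commute)
        also have "\<dots> \<in> W"
          using True m by (intro W.m_closed subgroup_int_pow_closed[OF W])
        finally show False using insert.prems by simp
      qed
      moreover have "(x [^] ?m) [^] p = \<one>"
        using insert by (simp add: nat_pow_pow mult.commute)
      ultimately show ?thesis
        using p insert.prems nat_pow_closed by blast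
    qed
  qed
  from this[OF finite_primes _ x exponent[OF x(1)]] show ?thesis by simp
qed

text \<open>Among the subgroups meeting \<open>H\<close> trivially one of maximal order is a
  complement: otherwise an element \<open>y\<close> of prime order outside \<open>H <#> K\<close>
  could be adjoined to \<open>K\<close>.\<close>

lemma exists_complement:
  assumes H: "subgroup H G"
  obtains K where "subgroup K G" "H \<inter> K = {\<one>}" "H <#> K = carrier G"
proof -
  interpret H: subgroup H G by (rule H)
  let ?S = "{K. subgroup K G \<and> H \<inter> K = {\<one>}}"
  have "{\<one>} \<in> ?S"
    using triv_subgroup by auto
  moreover have "\<forall>K. K \<in> ?S \<longrightarrow> card K < Suc (card (carrier G))"
    using card_mono[OF finite_carrier] subgroup.subset by (auto simp: less_Suc_eq_le)
  ultimately have *: "arg_max card (\<lambda>K. K \<in> ?S) \<in> ?S \<and>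
      (\<forall>K'. K' \<in> ?S \<longrightarrow> card K' \<le> card (arg_max card (\<lambda>K. K \<in> ?S)))"
    by (rule arg_max_nat_lemma)
  define K where "K = arg_max card (\<lambda>K. K \<in> ?S)"
  have K: "K \<in> ?S"
    using * unfolding K_def by (rule conjunct1)
  have max: "card K' \<le> card K" if "K' \<in> ?S" for K'
    using conjunct2[OF *, rule_format, OF that] unfolding K_def .
  interpret K: subgroup K G using K by simp
  have KS: "subgroup K G" using K by simp
  interpret HK: subgroup "H <#> K" G
    using mult_subgroups[OF H KS] .
  have KHK: "K \<subseteq> H <#> K"
    by (rule subset_set_mult_right[OF H.one_closed K.subset])
  have "H <#> K = carrier G"
  proof (rule ccontr)
    assume "H <#> K \<noteq> carrier G"
    then obtain x where "x \<in> carrier G" "x \<notin> H <#> K"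
      using HK.subset by blast
    then obtain p y where p: "prime (p::nat)" and y: "y \<in> carrier G" "y \<notin> H <#> K" "y [^] p = \<one>"
      using prime_order_element_outside[OF HK.subgroup_axioms] by blast
    let ?Y = "generate G {y}"
    have Y: "subgroup ?Y G" using y by (intro generate_is_subgroup) auto
    interpret Y: subgroup ?Y G by (rule Y)
    \<comment> \<open>A nontrivial power of an element of prime order has that element as one of its
      own powers, so it cannot lie in \<open>H <#> K\<close> without bringing \<open>y\<close>
      along.\<close>
    have YHK: "z = \<one>" if z: "z \<in> ?Y" "z \<in> H <#> K" for z
    proof -
      obtain i :: int where i: "z = y [^] i"
        using z(1) generate_pow[OF y(1)] by auto
      show ?thesis
      proof (cases "int p dvd i")
        case True
        then obtain j where "i = int p * j" by blast
        then show ?thesis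
          using i y by (simp add: int_pow_pow[symmetric] int_pow_int)
      next
        case False
        then have "coprime (int p) i"
          using p by (simp add: prime_imp_coprime)
        then obtain u v :: int where uv: "u * int p + v * i = 1"
          using bezout_int[of "int p" i] by (auto simp: coprime_iff_gcd_eq_1)
        have "y = y [^] (int p * u + i * v)"
          using uv y by (simp add: mult.commute)
        also have "\<dots> = z [^] v"
          using y i by (simp add: int_pow_mult int_pow_pow[symmetric] int_pow_int)
        also have "\<dots> \<in> H <#> K"
          using z by (intro subgroup_int_pow_closed[OF HK.subgroup_axioms])
        finally show ?thesis using y by simp
      qed
    qed
    have sub: "subgroup (K <#> ?Y) G"
      by (rule mult_subgroups[OF KS Y])
    \<comment> \<open>If \<open>h = k z\<close>, then \<open>z = h k^-1\<close> lies in
      \<open>H <#> K\<close> and is trivial by \<open>YHK\<close>, which leaves \<open>h = k\<close>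
      in \<open>H \<inter> K\<close>.\<close>
    have "H \<inter> (K <#> ?Y) \<subseteq> {\<one>}"
    proof
      fix h assume h: "h \<in> H \<inter> (K <#> ?Y)"
      then obtain k z where kz: "k \<in> K" "z \<in> ?Y" "h = k \<otimes> z"
        by (auto simp: set_mult_def)
      have car: "h \<in> carrier G" "k \<in> carrier G" "z \<in> carrier G"
        using h kz H.subset K.subset Y.subset by auto
      have "z = h \<otimes> inv k"
        using kz(3) car by (metis inv_closed inv_solve_left m_comm m_closed)
      then have "z \<in> H <#> K"
        using h kz by (auto simp: set_mult_def)
      then have "z = \<one>" using YHK kz by simp
      then have "h = k" using kz car by simp
      then show "h \<in> {\<one>}" using h kz K by auto
    qed
    then have "K <#> ?Y \<in> ?S"
      using sub H.one_closed subgroup.one_closed[OF sub] by auto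
    then have "card (K <#> ?Y) \<le> card K" by (rule max)
    moreover have "K \<subset> K <#> ?Y"
    proof
      show "K \<subseteq> K <#> ?Y"
        by (rule subset_set_mult_left[OF Y.one_closed K.subset])
      have "y \<in> ?Y" by (simp add: generate.incl)
      then have "y \<in> K <#> ?Y"
        using subset_set_mult_right[OF K.one_closed Y.subset] by blast
      then show "K \<noteq> K <#> ?Y" using y KHK by blast
    qed
    moreover have "finite (K <#> ?Y)"
      using subgroup.subset[OF sub] finite_carrier finite_subset by blast
    ultimately show False
      using psubset_card_mono by (metis leD)
  qed
  with K show thesis using that by blast
qed

text \<open>The modular law: a complement of \<open>H\<close> in the whole group, intersected with
  \<open>B\<close>, is a complement in \<open>B\<close>.\<close>

lemma exists_complement_in:
  assumes H: "subgroup H G" and B: "subgroup B G" and HB: "H \<subseteq> B"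
  obtains K where "subgroup K G" "H \<inter> K = {\<one>}" "H <#> K = B"
proof -
  obtain K where K: "subgroup K G" "H \<inter> K = {\<one>}" "H <#> K = carrier G"
    using exists_complement[OF H] .
  interpret H: subgroup H G by (rule H)
  interpret B: subgroup B G by (rule B)
  interpret K: subgroup K G by (rule K)
  have "subgroup (K \<inter> B) G"
    using subgroups_Inter_pair K(1) B by blast
  moreover have "H \<inter> (K \<inter> B) = {\<one>}"
    using K(2) B.one_closed by auto
  moreover have "H <#> (K \<inter> B) = B"
  proof
    show "H <#> (K \<inter> B) \<subseteq> B"
      using HB by (auto simp: set_mult_def)
    show "B \<subseteq> H <#> (K \<inter> B)"
    proof
      fix b assume b: "b \<in> B"
      then have "b \<in> H <#> K" using K(3) B.subset by auto
      then obtain h k where hk: "h \<in> H" "k \<in> K" "b = h \<otimes> k"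
        by (auto simp: set_mult_def)
      have "k = inv h \<otimes> b"
        using hk H.subset K.subset by (auto simp: m_assoc[symmetric] subset_iff)
      moreover have "inv h \<otimes> b \<in> B" using hk(1) b HB by auto
      ultimately have "k \<in> B" by simp
      then show "b \<in> H <#> (K \<inter> B)" using hk by (auto simp: set_mult_def)
    qed
  qed
  ultimately show thesis using that by blast
qed

end

text \<open>The codomain is all of \<open>G\<close> and the target enters only as an image, so that
  maps on complementary factors can be multiplied inside \<open>G\<close>.\<close>

definition subgroup_iso :: "('a, 'm) monoid_scheme \<Rightarrow> ('a \<Rightarrow> 'a) \<Rightarrow> 'a set \<Rightarrow> 'a set \<Rightarrow> bool"
  where "subgroup_iso G \<phi> H H' \<longleftrightarrow>
    \<phi> \<in> hom (G\<lparr>carrier := H\<rparr>) G \<and> inj_on \<phi> H \<and> \<phi> ` H = H'"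

text \<open>Both subgroups are cyclic, and \<open>x [^] i\<close> can be sent to
  \<open>y [^] i\<close> because equality of two powers depends only on the order of the
  generator.\<close>

lemma (in group) prime_order_subgroup_iso:
  assumes H: "subgroup H G" "card H = p" and H': "subgroup H' G" "card H' = p" and p: "prime (p::nat)"
  shows "\<exists>\<phi>. subgroup_iso G \<phi> H H'"
proof -
  have gen: "\<exists>x\<in>carrier G. ord x = p \<and> B = generate G {x}" if B: "subgroup B G" "card B = p" for B
  proof -
    interpret B: subgroup B G by (rule B)
    have fin: "finite B" using B p by (metis card.infinite not_prime_0)
    have "card B > 1" using B p prime_gt_1_nat by simp
    then obtain x where x: "x \<in> B" "x \<noteq> \<one>"
      by (metis B.one_closed card_le_Suc0_iff_eq fin leD One_nat_def)
    have xc: "x \<in> carrier G" using x B.subset by auto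
    have sub: "subgroup (generate G {x}) G" using xc by (intro generate_is_subgroup) auto
    have incl: "generate G {x} \<subseteq> B" using x B by (intro generate_subgroup_incl) auto
    interpret GB: group "G\<lparr>carrier := B\<rparr>" by (rule subgroup_imp_group[OF B(1)])
    have "card (generate G {x}) dvd p"
      using GB.lagrange_finite[OF _ subgroup_incl[OF sub B(1) incl]] fin B
      by (auto simp: order_def intro: dvdI)
    moreover have "card (generate G {x}) \<noteq> 1"
      using x generate.incl[of x "{x}" G] generate.one[of G "{x}"]
      by (metis card_1_singletonE singletonD singletonI)
    ultimately have "card (generate G {x}) = p"
      using p by (metis prime_nat_iff)
    then have "generate G {x} = B"
      using incl fin B by (metis card_subset_eq)
    moreover have "ord x = p"
      using \<open>card (generate G {x}) = p\<close> generate_pow_card[OF xc] by simp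
    ultimately show ?thesis using xc by auto
  qed
  obtain x where x: "x \<in> carrier G" "ord x = p" "H = generate G {x}" using gen[OF H] by blast
  obtain y where y: "y \<in> carrier G" "ord y = p" "H' = generate G {y}" using gen[OF H'] by blast
  have Hx: "H = range (\<lambda>i::int. x [^] i)" using generate_pow[OF x(1)] x by auto
  have Hy: "H' = range (\<lambda>i::int. y [^] i)" using generate_pow[OF y(1)] y by auto
  have eq: "x [^] (i::int) = x [^] (j::int) \<longleftrightarrow> y [^] i = y [^] j" for i j
    using x y by (simp add: int_pow_eq)
  define \<phi> where "\<phi> z = y [^] (SOME i::int. z = x [^] i)" for z
  have \<phi>: "\<phi> (x [^] i) = y [^] i" for i :: int
  proof -
    have "x [^] i = x [^] (SOME j::int. x [^] i = x [^] j)"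
      by (rule someI[of _ i]) simp
    then show ?thesis
      unfolding \<phi>_def by (simp add: eq[symmetric])
  qed
  have "\<phi> \<in> hom (G\<lparr>carrier := H\<rparr>) G"
  proof (rule homI)
    fix z assume "z \<in> carrier (G\<lparr>carrier := H\<rparr>)"
    then show "\<phi> z \<in> carrier G" using Hx \<phi> y by auto
  next
    fix z w assume "z \<in> carrier (G\<lparr>carrier := H\<rparr>)" "w \<in> carrier (G\<lparr>carrier := H\<rparr>)"
    then obtain i j :: int where "z = x [^] i" "w = x [^] j" using Hx by auto
    then show "\<phi> (z \<otimes>\<^bsub>G\<lparr>carrier := H\<rparr>\<^esub> w) = \<phi> z \<otimes> \<phi> w"
      using x y by (simp add: \<phi> int_pow_mult[symmetric])
  qed
  moreover have "inj_on \<phi> H"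
    unfolding Hx inj_on_def by (auto simp: \<phi> eq)
  moreover have "\<phi> ` H = H'"
    unfolding Hx Hy by (auto simp: \<phi> image_iff)
  ultimately show ?thesis unfolding subgroup_iso_def by blast
qed

text \<open>The glued map is onto \<open>H' <#> K'\<close> by construction; equality of finite
  cardinalities then makes it injective, so \<open>H' \<inter> K'\<close> need not be
  examined.\<close>

lemma (in comm_group) subgroup_iso_glue:
  assumes H: "subgroup H G" and K: "subgroup K G" "H \<inter> K = {\<one>}"
    and \<phi>: "subgroup_iso G \<phi> H H'" and \<psi>: "subgroup_iso G \<psi> K K'"
    and fin: "finite (H <#> K)" and card: "card (H <#> K) = card (H' <#> K')"
  shows "\<exists>\<theta>. subgroup_iso G \<theta> (H <#> K) (H' <#> K') \<and> (\<forall>h\<in>H. \<theta> h = \<phi> h)"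
proof -
  interpret H: subgroup H G by (rule H)
  interpret K: subgroup K G by (rule K)
  have hom: "\<phi> \<in> hom (G\<lparr>carrier := H\<rparr>) G" "\<psi> \<in> hom (G\<lparr>carrier := K\<rparr>) G"
    and im: "\<phi> ` H = H'" "\<psi> ` K = K'"
    using \<phi> \<psi> by (auto simp: subgroup_iso_def)
  obtain \<theta> where \<theta>: "\<theta> \<in> hom (G\<lparr>carrier := H <#> K\<rparr>) G"
    and \<theta>_eq: "\<And>h k. h \<in> H \<Longrightarrow> k \<in> K \<Longrightarrow> \<theta> (h \<otimes> k) = \<phi> h \<otimes> \<psi> k"
    using hom_glue_complements[OF H K comm_group_axioms hom] by blast
  have "\<theta> ` (H <#> K) = H' <#> K'"
    unfolding im[symmetric] by (force simp: set_mult_def \<theta>_eq image_iff)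
  moreover from this have "inj_on \<theta> (H <#> K)"
    using fin card by (intro eq_card_imp_inj_on) auto
  moreover have "\<theta> h = \<phi> h" if "h \<in> H" for h
  proof -
    interpret KG: group "G\<lparr>carrier := K\<rparr>" by (rule subgroup_imp_group[OF K(1)])
    have "\<psi> \<one> = \<one>"
      using hom_one[OF hom(2) KG.is_group is_group] by simp
    then show ?thesis
      using \<theta>_eq[OF that K.one_closed] that hom(1) H.subset by (auto simp: hom_def Pi_iff)
  qed
  ultimately show ?thesis
    using \<theta> unfolding subgroup_iso_def by blast
qed

section \<open>Isomorphisms between subgroups of equal order, compatible with flags\<close>

context squarefree_exponent_group
begin

lemma subgroup_finite: "subgroup H G \<Longrightarrow> finite H"
  using subgroup.subset finite_carrier finite_subset by blast

text \<open>A subgroup of the same prime order is split off on both sides; the complements have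
  equal smaller order, so the induction hypothesis applies to them.\<close>

lemma equal_card_subgroup_iso:
  assumes "subgroup B G" "subgroup B' G" "card B = card B'"
  shows "\<exists>\<phi>. subgroup_iso G \<phi> B B'"
  using assms
proof (induction "card B" arbitrary: B B' rule: less_induct)
  case less
  interpret B: subgroup B G by fact
  interpret B': subgroup B' G by fact
  have fin: "finite B" "finite B'" using less.prems subgroup_finite by auto
  show ?case
  proof (cases "card B = 1")
    case True
    then have "B = {\<one>}" "B' = {\<one>}"
      using B.one_closed B'.one_closed less.prems by (metis card_1_singletonE singletonD)+
    then have "subgroup_iso G (\<lambda>x. x) B B'"
      by (auto simp: subgroup_iso_def hom_def)
    then show ?thesis by blast
  next
    case False
    then obtain p where p: "prime p" "p dvd card B"
      using prime_factor_nat by blast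
    \<comment> \<open>Cauchy's theorem, obtained from Sylow's with exponent one.\<close>
    have cauchy: "\<exists>H. subgroup H G \<and> H \<subseteq> C \<and> card H = p" if C: "subgroup C G" "p dvd card C" for C
    proof -
      obtain m where "card C = p ^ 1 * m" using C by auto
      then obtain H where "subgroup H (G\<lparr>carrier := C\<rparr>)" "card H = p ^ 1"
        using sylow_thm[OF p(1) subgroup_imp_group[OF C(1)], of 1 m] subgroup_finite[OF C(1)]
        by (auto simp: order_def)
      then show ?thesis
        using incl_subgroup[OF C(1)] subgroup.subset by fastforce
    qed
    obtain H where H: "subgroup H G" "H \<subseteq> B" "card H = p"
      using cauchy[of B] p less.prems by auto
    obtain H' where H': "subgroup H' G" "H' \<subseteq> B'" "card H' = p"
      using cauchy[of B'] p less.prems by auto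
    obtain K where K: "subgroup K G" "H \<inter> K = {\<one>}" "H <#> K = B"
      using exists_complement_in[OF H(1) less.prems(1) H(2)] .
    obtain K' where K': "subgroup K' G" "H' \<inter> K' = {\<one>}" "H' <#> K' = B'"
      using exists_complement_in[OF H'(1) less.prems(2) H'(2)] .
    have cB: "card B = p * card K" "card B' = p * card K'"
      using card_set_mult_complements[OF H(1) K(1,2)] card_set_mult_complements[OF H'(1) K'(1,2)]
        H H' K K' by auto
    have "card B > 0" using fin(1) B.one_closed card_gt_0_iff by blast
    then have "card K < card B" using cB p prime_gt_1_nat[OF p(1)] by simp
    moreover have "card K = card K'" using cB less.prems(3) p(1) by (auto simp: not_prime_0)
    ultimately obtain \<psi> where "subgroup_iso G \<psi> K K'" using less.hyps K K' by blast
    moreover obtain \<phi> where "subgroup_iso G \<phi> H H'"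
      using prime_order_subgroup_iso[OF H(1,3) H'(1,3) p(1)] by blast
    ultimately show ?thesis
      using subgroup_iso_glue[OF H(1) K(1,2)] K K' fin less.prems by metis
  qed
qed

text \<open>Complements of \<open>H\<close> in \<open>B\<close> and of \<open>H'\<close> in
  \<open>B'\<close> have the same order by counting, hence are isomorphic; such an isomorphism is
  glued to \<open>\<phi>\<close>.\<close>

lemma subgroup_iso_extend:
  assumes H: "subgroup H G" "subgroup B G" "H \<subseteq> B"
    and H': "subgroup H' G" "subgroup B' G" "H' \<subseteq> B'"
    and card: "card B = card B'" and \<phi>: "subgroup_iso G \<phi> H H'"
  shows "\<exists>\<theta>. subgroup_iso G \<theta> B B' \<and> (\<forall>h\<in>H. \<theta> h = \<phi> h)"
proof -
  obtain K where K: "subgroup K G" "H \<inter> K = {\<one>}" "H <#> K = B"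
    using exists_complement_in[OF H] .
  obtain K' where K': "subgroup K' G" "H' \<inter> K' = {\<one>}" "H' <#> K' = B'"
    using exists_complement_in[OF H'] .
  have "card H = card H'"
    using \<phi> by (metis card_image subgroup_iso_def)
  moreover have "card H > 0"
    using subgroup_finite[OF H(1)] subgroup.one_closed[OF H(1)] by (auto simp: card_gt_0_iff)
  moreover have "card B = card H * card K" "card B' = card H' * card K'"
    using card_set_mult_complements[OF H(1) K(1,2)] card_set_mult_complements[OF H'(1) K'(1,2)] K K'
    by auto
  ultimately have "card K = card K'" using card by auto
  then obtain \<psi> where "subgroup_iso G \<psi> K K'" using equal_card_subgroup_iso K K' by blast
  then show ?thesis
    using subgroup_iso_glue[OF H(1) K(1,2) \<phi>] K K' card subgroup_finite[OF H(2)] by metis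
qed

text \<open>An arbitrary isomorphism from \<open>L\<close> to \<open>L'\<close> is extended to
  \<open>U\<close> and then to \<open>G\<close>; each extension keeps the earlier values and with
  them the earlier images.\<close>

lemma exists_auto_mapping_flag:
  assumes L: "subgroup L G" "subgroup U G" "L \<subseteq> U"
    and L': "subgroup L' G" "subgroup U' G" "L' \<subseteq> U'"
    and card: "card L = card L'" "card U = card U'"
  obtains \<theta> where "\<theta> \<in> auto G" "\<theta> ` L = L'" "\<theta> ` U = U'"
proof -
  obtain \<theta>1 where 1: "subgroup_iso G \<theta>1 L L'"
    using equal_card_subgroup_iso[OF L(1) L'(1) card(1)] by blast
  obtain \<theta>2 where 2: "subgroup_iso G \<theta>2 U U'" "\<forall>h\<in>L. \<theta>2 h = \<theta>1 h"
    using subgroup_iso_extend[OF L L' card(2) 1] by blast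
  obtain \<theta>3 where 3: "subgroup_iso G \<theta>3 (carrier G) (carrier G)" "\<forall>h\<in>U. \<theta>3 h = \<theta>2 h"
    using subgroup_iso_extend[OF L(2) subgroup_self _ L'(2) subgroup_self _ refl 2(1)]
      L(2) L'(2) subgroup.subset by blast
  \<comment> \<open>Members of \<open>auto\<close> are extensional, so the values outside the
    carrier have to be normalized.\<close>
  let ?\<theta> = "restrict \<theta>3 (carrier G)"
  have "?\<theta> \<in> auto G"
    using 3(1) by (auto simp: auto_def Bij_def subgroup_iso_def bij_betw_def hom_def
        intro: inj_on_cong[THEN iffD1])
  moreover have "?\<theta> ` L = \<theta>1 ` L" "?\<theta> ` U = \<theta>2 ` U"
    using 2(2) 3(2) L(3) subgroup.subset[OF L(2)] by (auto intro!: image_cong simp: subset_iff)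
  ultimately show thesis
    using that 1 2 by (auto simp: subgroup_iso_def)
qed

end

section \<open>Direct products of elementary abelian groups\<close>

lemma squarefree_exponent_group_product:
  fixes G :: "('a, 'm) monoid_scheme" (structure) and E :: "'i \<Rightarrow> ('b, 'n) monoid_scheme"
  assumes G: "group G" "finite (carrier G)" and I: "finite I"
    and E: "\<And>i. i \<in> I \<Longrightarrow> elementary_abelian (E i)" and iso: "G \<cong> product_group I E"
  obtains Q where "squarefree_exponent_group G Q"
proof -
  interpret group G by (rule G)
  let ?E = "product_group I E"
  have Ecg: "comm_group (E i)" if "i \<in> I" for i using E that by (auto simp: elementary_abelian_def)
  then have Eg: "group (E i)" if "i \<in> I" for i using that by (simp add: comm_group_def)
  interpret P: group ?E using Eg by (rule product_group)
  obtain p where p: "\<And>i. i \<in> I \<Longrightarrow> prime (p i)"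
    "\<And>i x. i \<in> I \<Longrightarrow> x \<in> carrier (E i) \<Longrightarrow> x [^]\<^bsub>E i\<^esub> (p i :: nat) = \<one>\<^bsub>E i\<^esub>"
    using E unfolding elementary_abelian_def by metis
  \<comment> \<open>As a set of primes: a prime shared by several factors counts once, so the
    exponent is squarefree.\<close>
  let ?Q = "p ` I"
  obtain \<phi> where \<phi>: "\<phi> \<in> iso G ?E" using iso by (auto simp: is_iso_def)
  interpret \<phi>: group_hom G ?E \<phi>
    using \<phi> by (unfold_locales) (auto simp: iso_def)
  have inj: "inj_on \<phi> (carrier G)" using \<phi> by (auto simp: iso_def bij_betw_def)
  have comm: "comm_group G"
  proof (unfold_locales)
    fix x y assume xy: "x \<in> carrier G" "y \<in> carrier G"
    then have "\<phi> x \<in> carrier ?E" "\<phi> y \<in> carrier ?E"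
      using \<phi>.hom_closed by blast+
    then have "\<phi> x \<otimes>\<^bsub>?E\<^esub> \<phi> y = \<phi> y \<otimes>\<^bsub>?E\<^esub> \<phi> x"
      using Ecg by (auto simp: PiE_iff intro!: restrict_ext comm_groupE(4))
    then have "\<phi> (x \<otimes> y) = \<phi> (y \<otimes> x)" using xy by simp
    then show "x \<otimes> y = y \<otimes> x" by (rule inj_onD[OF inj]) (use xy in auto)
  qed
  have pow: "x [^]\<^bsub>?E\<^esub> (n::nat) = (\<lambda>i\<in>I. x i [^]\<^bsub>E i\<^esub> n)" if "x \<in> carrier ?E" for x n
    using that by (induction n) auto
  have exp: "x [^] \<Prod>?Q = \<one>" if x: "x \<in> carrier G" for x
  proof -
    have "\<phi> x i [^]\<^bsub>E i\<^esub> \<Prod>?Q = \<one>\<^bsub>E i\<^esub>" if i: "i \<in> I" for i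
    proof -
      interpret Ei: group "E i" using Eg i .
      have xi: "\<phi> x i \<in> carrier (E i)" using \<phi>.hom_closed[OF x] i by (auto simp: PiE_iff)
      have "p i dvd \<Prod>?Q" using I i by (intro dvd_prodI[of _ _ id, simplified]) auto
      then obtain k where "\<Prod>?Q = p i * k" by blast
      then show ?thesis using p(2)[OF i xi] xi by (simp add: Ei.nat_pow_pow[symmetric])
    qed
    then have "\<phi> x [^]\<^bsub>?E\<^esub> \<Prod>?Q = \<one>\<^bsub>?E\<^esub>"
      using pow[OF \<phi>.hom_closed[OF x]] by (auto intro: restrict_ext)
    then have "\<phi> (x [^] \<Prod>?Q) = \<phi> \<one>" using x by (simp add: \<phi>.hom_nat_pow)
    then show ?thesis by (rule inj_onD[OF inj]) (use x in auto)
  qed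
  have "squarefree_exponent_group G ?Q"
    using comm G(2) I p(1) exp
    by (auto simp: squarefree_exponent_group_def squarefree_exponent_group_axioms_def)
  then show thesis by (rule that)
qed

section \<open>S-rings as partitions\<close>

text \<open>The coefficient at a block is the value of \<open>a\<close> at any chosen point of it.
  This replaces membership in a span by a condition free of sums.\<close>

lemma int_span_iff:
  assumes fin: "finite C" and P: "partition_on C P"
  shows "a \<in> int_span P \<longleftrightarrow>
    (\<forall>g. g \<notin> C \<longrightarrow> a g = 0) \<and> (\<forall>X\<in>P. \<forall>x\<in>X. \<forall>y\<in>X. a x = a y)"
proof (intro iffI conjI; (elim conjE)?)
  assume a: "a \<in> int_span P"
  then show "\<forall>X\<in>P. \<forall>x\<in>X. \<forall>y\<in>X. a x = a y"
    using int_span_block_const[OF P] by blast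
  have "X \<subseteq> C" if "X \<in> P" for X
    using P that by (auto simp: partition_on_def)
  then have "underl X g = 0" if "X \<in> P" "g \<notin> C" for X g
    using that by (auto simp: underl_def indicator_def)
  then show "\<forall>g. g \<notin> C \<longrightarrow> a g = 0"
    using a by (auto simp: int_span_def intro!: sum.neutral)
next
  assume zero: "\<forall>g. g \<notin> C \<longrightarrow> a g = 0" and const: "\<forall>X\<in>P. \<forall>x\<in>X. \<forall>y\<in>X. a x = a y"
  have finP: "finite P" using finite_elements[OF fin P] .
  define c where "c X = a (SOME x. x \<in> X)" for X
  have "a g = (\<Sum>X\<in>P. c X * underl X g)" for g
  proof (cases "g \<in> C")
    case True
    then obtain Y where Y: "Y \<in> P" "g \<in> Y" using P by (auto simp: partition_on_def)
    have "g \<in> X \<longleftrightarrow> X = Y" if "X \<in> P" for X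
      using P Y that by (auto simp: partition_on_def disjoint_def)
    then have "(\<Sum>X\<in>P. c X * underl X g) = (\<Sum>X\<in>P. if X = Y then c X else 0)"
      by (intro sum.cong) (auto simp: underl_def)
    also have "\<dots> = c Y" using finP Y by simp
    also have "c Y = a g"
      unfolding c_def using const Y someI[of "\<lambda>x. x \<in> Y" g] by blast
    finally show ?thesis by simp
  next
    case False
    have "X \<subseteq> C" if "X \<in> P" for X
      using P that by (auto simp: partition_on_def)
    with False have "(\<Sum>X\<in>P. c X * underl X g) = 0"
      by (intro sum.neutral) (auto simp: underl_def indicator_def)
    with False zero show ?thesis by simp
  qed
  then show "a \<in> int_span P"
    unfolding int_span_def by blast
qed

text \<open>The combinatorial form of an \<open>A\<close>-set, a set whose characteristic function
  belongs to the S-ring with basic sets \<open>P\<close>.\<close>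

definition union_of_blocks :: "'a set set \<Rightarrow> 'a set \<Rightarrow> bool"
  where "union_of_blocks P W \<longleftrightarrow> W \<subseteq> \<Union>P \<and> (\<forall>X\<in>P. X \<subseteq> W \<or> X \<inter> W = {})"

lemma underl_in_int_span_iff:
  assumes fin: "finite C" and P: "partition_on C P"
  shows "underl W \<in> int_span P \<longleftrightarrow> union_of_blocks P W"
proof -
  have "\<Union>P = C" using P by (simp add: partition_on_def)
  then show ?thesis
    unfolding int_span_iff[OF assms] union_of_blocks_def underl_def indicator_def
    by (auto split: if_splits)
qed

lemma union_of_blocksE:
  assumes "union_of_blocks P W" "w \<in> W"
  obtains X where "X \<in> P" "w \<in> X" "X \<subseteq> W"
proof -
  obtain X where X: "X \<in> P" "w \<in> X"
    using assms unfolding union_of_blocks_def by auto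
  then have "X \<subseteq> W"
    using assms unfolding union_of_blocks_def by auto
  with X show thesis using that by blast
qed

lemma Union_blocks_eq:
  assumes "union_of_blocks P W"
  shows "\<Union>{X \<in> P. X \<subseteq> W} = W"
proof (intro subset_antisym subsetI)
  fix w assume "w \<in> W"
  then show "w \<in> \<Union>{X \<in> P. X \<subseteq> W}"
    using union_of_blocksE[OF assms] by blast
qed auto

lemma block_union_of_blocks:
  assumes "partition_on C P" "X \<in> P"
  shows "union_of_blocks P X"
  using assms unfolding union_of_blocks_def partition_on_def disjoint_def by blast

text \<open>Carries agreement on blocks over to \<open>L\<close> and \<open>U\<close>, for maps that
  may well differ at every single point.\<close>

lemma image_eq_if_blocks_image_eq:
  assumes "union_of_blocks P W" "\<And>X. X \<in> P \<Longrightarrow> X \<subseteq> W \<Longrightarrow> f ` X = g ` X"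
  shows "f ` W = g ` W"
proof -
  have "W = \<Union>{X \<in> P. X \<subseteq> W}"
    by (rule Union_blocks_eq[OF assms(1), symmetric])
  then have "f ` W = \<Union>((`) f ` {X \<in> P. X \<subseteq> W})" "g ` W = \<Union>((`) g ` {X \<in> P. X \<subseteq> W})"
    by (metis image_Union)+
  then show ?thesis using assms(2) by auto
qed

section \<open>Convolution, and S-rings of subgroups and quotients\<close>

lemma (in group) group_ring_mult_eq:
  assumes "g \<in> carrier G"
  shows "(a \<otimes>\<^bsub>group_ring G\<^esub> b) g = (\<Sum>h\<in>carrier G. a h * b (inv h \<otimes> g))"
proof -
  have "(\<Sum>(h, k) \<in> {(h, k) \<in> carrier G \<times> carrier G. h \<otimes> k = g}. a h * b k)
      = (\<Sum>h\<in>carrier G. a h * b (inv h \<otimes> g))"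
    by (rule sum.reindex_bij_witness[of _ "\<lambda>h. (h, inv h \<otimes> g)" fst])
      (use assms in \<open>auto simp: m_assoc[symmetric]\<close>)
  then show ?thesis by (simp add: group_ring_def)
qed

lemma (in monoid) group_ring_mult_outside:
  assumes "g \<notin> carrier G"
  shows "(a \<otimes>\<^bsub>group_ring G\<^esub> b) g = 0"
  using assms by (auto simp: group_ring_def intro!: sum.neutral)

text \<open>S-rings are handled through their basic sets. Of the subring axioms only closure under
  multiplication is demanded: a span is additively closed, and the unit is the characteristic
  function of the block of the identity.\<close>

definition s_partition :: "('a, 'm) monoid_scheme \<Rightarrow> 'a set set \<Rightarrow> bool"
  where "s_partition G P \<longleftrightarrow>
    partition_on (carrier G) P \<and> {\<one>\<^bsub>G\<^esub>} \<in> P \<and> (\<forall>X\<in>P. m_inv G ` X \<in> P) \<and>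
    (\<forall>a\<in>int_span P. \<forall>b\<in>int_span P. a \<otimes>\<^bsub>group_ring G\<^esub> b \<in> int_span P)"

lemma s_partition_partition: "s_partition G P \<Longrightarrow> partition_on (carrier G) P"
  by (simp add: s_partition_def)

lemma s_partition_subset: "s_partition G P \<Longrightarrow> X \<in> P \<Longrightarrow> X \<subseteq> carrier G"
  by (auto simp: s_partition_def partition_on_def)

lemma s_partition_Union: "s_partition G P \<Longrightarrow> \<Union>P = carrier G"
  by (auto simp: s_partition_def partition_on_def)

lemma basic_sets_s_partition:
  assumes "finite (carrier G)" "s_partition G P"
  shows "basic_sets G (int_span P) = P"
  using assms by (intro basic_sets_eq) (auto simp: s_partition_def basic_partition_def)

lemma s_ring_iff_s_partition:
  assumes fin: "finite (carrier G)"
  shows "s_ring G A \<longleftrightarrow> (\<exists>P. s_partition G P \<and> A = int_span P)"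
proof
  assume "s_ring G A"
  then obtain P where sub: "subring A (group_ring G)" and P: "basic_partition G A P"
    by (auto simp: s_ring_def)
  interpret subring A "group_ring G" by (rule sub)
  have "s_partition G P"
    using P submonoid.m_closed[OF submonoid_axioms] by (auto simp: s_partition_def basic_partition_def)
  then show "\<exists>P. s_partition G P \<and> A = int_span P"
    using P by (auto simp: basic_partition_def)
next
  assume "\<exists>P. s_partition G P \<and> A = int_span P"
  then obtain P where P: "s_partition G P" and A: "A = int_span P" by blast
  note part = s_partition_partition[OF P]
  note iff = int_span_iff[OF fin part]
  have sub: "int_span P \<subseteq> carrier (group_ring G)"
    by (auto simp: iff group_ring_def)
  \<comment> \<open>\<open>m_inv\<close> is a definite description, so the pointwise negative is
    checked to be an inverse and the only one.\<close>
  have inv: "inv\<^bsub>add_monoid (group_ring G)\<^esub> a = (\<lambda>g. - a g)" if "a \<in> int_span P" for a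
    unfolding m_inv_def
  proof (rule the_equality)
    show "(\<lambda>g. - a g) \<in> carrier (add_monoid (group_ring G)) \<and>
      a \<otimes>\<^bsub>add_monoid (group_ring G)\<^esub> (\<lambda>g. - a g) = \<one>\<^bsub>add_monoid (group_ring G)\<^esub> \<and>
      (\<lambda>g. - a g) \<otimes>\<^bsub>add_monoid (group_ring G)\<^esub> a = \<one>\<^bsub>add_monoid (group_ring G)\<^esub>"
      using that by (auto simp: iff group_ring_def)
  next
    fix b
    assume "b \<in> carrier (add_monoid (group_ring G)) \<and>
      a \<otimes>\<^bsub>add_monoid (group_ring G)\<^esub> b = \<one>\<^bsub>add_monoid (group_ring G)\<^esub> \<and>
      b \<otimes>\<^bsub>add_monoid (group_ring G)\<^esub> a = \<one>\<^bsub>add_monoid (group_ring G)\<^esub>"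
    then show "b = (\<lambda>g. - a g)"
      by (auto simp: group_ring_def fun_eq_iff eq_neg_iff_add_eq_0)
  qed
  have "subgroup (int_span P) (add_monoid (group_ring G))"
  proof
    show "int_span P \<subseteq> carrier (add_monoid (group_ring G))" using sub by simp
    show "a \<otimes>\<^bsub>add_monoid (group_ring G)\<^esub> b \<in> int_span P"
      if "a \<in> int_span P" "b \<in> int_span P" for a b
    proof -
      have "(\<lambda>g. a g + b g) \<in> int_span P"
        unfolding iff using that[unfolded iff] by (intro conjI allI impI ballI) (simp, metis)
      then show ?thesis by (simp add: group_ring_def)
    qed
    show "\<one>\<^bsub>add_monoid (group_ring G)\<^esub> \<in> int_span P"
      by (auto simp: iff group_ring_def)
    show "inv\<^bsub>add_monoid (group_ring G)\<^esub> a \<in> int_span P" if "a \<in> int_span P" for a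
      unfolding inv[OF that] unfolding iff using that[unfolded iff]
      by (intro conjI allI impI ballI) (simp, metis)
  qed
  moreover have "submonoid (int_span P) (group_ring G)"
  proof
    show "int_span P \<subseteq> carrier (group_ring G)" by (rule sub)
    show "a \<otimes>\<^bsub>group_ring G\<^esub> b \<in> int_span P" if "a \<in> int_span P" "b \<in> int_span P" for a b
      using that P by (simp add: s_partition_def)
    have "underl {\<one>\<^bsub>G\<^esub>} \<in> int_span P"
      using P finite_elements[OF fin part] by (intro underl_in_int_span) (auto simp: s_partition_def)
    then show "\<one>\<^bsub>group_ring G\<^esub> \<in> int_span P"
      by (simp add: group_ring_def underl_def)
  qed
  ultimately have "subring A (group_ring G)"
    unfolding A by (rule subring.intro)
  moreover have "basic_partition G A P"
    using P A by (auto simp: s_partition_def basic_partition_def)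
  ultimately show "s_ring G A"
    by (auto simp: s_ring_def)
qed

text \<open>Nonnegative coefficients cannot cancel, so \<open>V <#> W\<close> is the support of the
  product of the two characteristic functions; that product is constant on blocks.\<close>

lemma (in group) set_mult_union_of_blocks:
  assumes fin: "finite (carrier G)" and P: "s_partition G P"
    and V: "union_of_blocks P V" and W: "union_of_blocks P W"
  shows "union_of_blocks P (V <#> W)"
proof -
  note part = s_partition_partition[OF P]
  have sub: "V \<subseteq> carrier G" "W \<subseteq> carrier G"
    using V W s_partition_Union[OF P] by (auto simp: union_of_blocks_def)
  let ?c = "underl V \<otimes>\<^bsub>group_ring G\<^esub> underl W"
  have c: "?c \<in> int_span P"
    using P V W by (auto simp: s_partition_def underl_in_int_span_iff[OF fin part])
  have supp: "?c g \<noteq> 0 \<longleftrightarrow> g \<in> V <#> W" if g: "g \<in> carrier G" for g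
  proof -
    have "?c g = 0 \<longleftrightarrow> (\<forall>h\<in>carrier G. underl V h * underl W (inv h \<otimes> g) = 0)"
      unfolding group_ring_mult_eq[OF g] using fin
      by (intro sum_nonneg_eq_0_iff) (auto simp: underl_def)
    also have "\<dots> \<longleftrightarrow> \<not> (\<exists>h\<in>V. inv h \<otimes> g \<in> W)"
      using sub by (auto simp: underl_def indicator_def)
    also have "(\<exists>h\<in>V. inv h \<otimes> g \<in> W) \<longleftrightarrow> g \<in> V <#> W"
    proof
      assume "\<exists>h\<in>V. inv h \<otimes> g \<in> W"
      then obtain h where h: "h \<in> V" "inv h \<otimes> g \<in> W" by blast
      then have "h \<otimes> (inv h \<otimes> g) \<in> V <#> W" by (rule set_mult_memI)
      moreover have "h \<otimes> (inv h \<otimes> g) = g" using h sub g by (auto simp: m_assoc[symmetric])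
      ultimately show "g \<in> V <#> W" by simp
    next
      assume "g \<in> V <#> W"
      then obtain h k where hk: "h \<in> V" "k \<in> W" "g = h \<otimes> k" by (auto simp: set_mult_def)
      then have "inv h \<otimes> g = k" using sub by (auto simp: m_assoc[symmetric] subset_iff)
      then show "\<exists>h\<in>V. inv h \<otimes> g \<in> W" using hk by (intro bexI[of _ h]) simp_all
    qed
    finally show ?thesis by simp
  qed
  have "X \<subseteq> V <#> W" if X: "X \<in> P" "x \<in> X" "x \<in> V <#> W" for X x
  proof
    fix y assume y: "y \<in> X"
    then have "?c y = ?c x" using int_span_block_const[OF part c X(1)] X by blast
    then show "y \<in> V <#> W"
      using supp X y s_partition_subset[OF P X(1)] by (metis subsetD)
  qed
  then show ?thesis
    using set_mult_closed[OF sub] s_partition_Union[OF P] unfolding union_of_blocks_def by blast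
qed

text \<open>Functions on \<open>U\<close> are read as functions on \<open>G\<close> that vanish
  outside \<open>U\<close>; the two convolutions then coincide, because every additional summand is
  zero.\<close>

lemma (in group) s_partition_subgroup:
  assumes fin: "finite (carrier G)" and P: "s_partition G P"
    and U: "subgroup U G" "union_of_blocks P U"
  shows "s_partition (G\<lparr>carrier := U\<rparr>) {X \<in> P. X \<subseteq> U}"
proof -
  interpret U: subgroup U G by (rule U)
  let ?U = "G\<lparr>carrier := U\<rparr>" and ?P = "{X \<in> P. X \<subseteq> U}"
  note part = s_partition_partition[OF P]
  have finU: "finite U" using fin U.subset finite_subset by blast
  have "\<Union>?P = U" by (rule Union_blocks_eq[OF U(2)])
  then have partU: "partition_on U ?P"
    using part by (auto simp: partition_on_def disjoint_def)
  have span: "a \<in> int_span P" if "a \<in> int_span ?P" for a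
    unfolding int_span_iff[OF fin part]
  proof (intro conjI allI impI ballI)
    show "a g = 0" if "g \<notin> carrier G" for g
      using \<open>a \<in> int_span ?P\<close> that U.subset unfolding int_span_iff[OF finU partU] by blast
    show "a x = a y" if X: "X \<in> P" "x \<in> X" "y \<in> X" for X x y
    proof (cases "X \<subseteq> U")
      case True
      then show ?thesis
        using \<open>a \<in> int_span ?P\<close> X unfolding int_span_iff[OF finU partU] by blast
    next
      case False
      then have "x \<notin> U" "y \<notin> U"
        using U(2) X unfolding union_of_blocks_def by auto
      then show ?thesis
        using \<open>a \<in> int_span ?P\<close> unfolding int_span_iff[OF finU partU] by simp
    qed
  qed
  have conv: "a \<otimes>\<^bsub>group_ring ?U\<^esub> b \<in> int_span ?P" if ab: "a \<in> int_span ?P" "b \<in> int_span ?P" for a b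
  proof -
    have zero: "a g = 0" "b g = 0" if "g \<notin> U" for g
      using ab that by (auto simp: int_span_iff[OF finU partU])
    have "(a \<otimes>\<^bsub>group_ring ?U\<^esub> b) g = (a \<otimes>\<^bsub>group_ring G\<^esub> b) g" for g
    proof -
      have "(\<Sum>(h, k) \<in> {(h, k) \<in> U \<times> U. h \<otimes> k = g}. a h * b k)
          = (\<Sum>(h, k) \<in> {(h, k) \<in> carrier G \<times> carrier G. h \<otimes> k = g}. a h * b k)"
      proof (rule sum.mono_neutral_left)
        show "finite {(h, k) \<in> carrier G \<times> carrier G. h \<otimes> k = g}"
          by (rule finite_subset[of _ "carrier G \<times> carrier G"]) (use fin in auto)
      next
        show "\<forall>i\<in>{(h, k) \<in> carrier G \<times> carrier G. h \<otimes> k = g} - {(h, k) \<in> U \<times> U. h \<otimes> k = g}.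
            (case i of (h, k) \<Rightarrow> a h * b k) = 0"
          using zero by fastforce
      qed (use U.subset in auto)
      then show ?thesis by (simp add: group_ring_def)
    qed
    then have eq: "a \<otimes>\<^bsub>group_ring ?U\<^esub> b = a \<otimes>\<^bsub>group_ring G\<^esub> b" by blast
    have "a \<otimes>\<^bsub>group_ring G\<^esub> b \<in> int_span P"
      using span[OF ab(1)] span[OF ab(2)] P by (auto simp: s_partition_def)
    moreover have "(a \<otimes>\<^bsub>group_ring ?U\<^esub> b) g = 0" if "g \<notin> U" for g
      using monoid.group_ring_mult_outside[OF group.is_monoid[OF subgroup_imp_group[OF U(1)]]] that
      by simp
    ultimately show ?thesis
      unfolding eq int_span_iff[OF finU partU] int_span_iff[OF fin part] by blast
  qed
  have "m_inv ?U ` X \<in> ?P" if X: "X \<in> ?P" for X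
  proof -
    have "m_inv ?U ` X = m_inv G ` X"
      using X U(1) by (intro image_cong) auto
    then show ?thesis using X P by (auto simp: s_partition_def)
  qed
  then show ?thesis
    unfolding s_partition_def using partU conv P by (auto simp: s_partition_def)
qed

text \<open>Functions on the quotient are pulled back to \<open>G\<close>. The convolution of the
  pullbacks is \<open>card L\<close> times the pullback of the convolution, so constancy on blocks
  descends.\<close>

lemma (in group) s_partition_quotient:
  assumes fin: "finite (carrier G)" and P: "s_partition G P"
    and L: "L \<lhd> G" "union_of_blocks P L"
  shows "s_partition (G Mod L) ((`) ((#>) L) ` P)"
proof -
  interpret L: normal L G by (rule L)
  let ?M = "G Mod L" and ?\<pi> = "(#>) L" and ?P = "(`) ((#>) L) ` P"
  interpret M: group ?M by (rule L.factorgroup_is_group)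
  interpret \<pi>: group_hom G ?M ?\<pi>
    by unfold_locales (rule L.r_coset_hom_Mod)
  note part = s_partition_partition[OF P]
  have carM: "carrier ?M = ?\<pi> ` carrier G" by (rule carrier_FactGroup)
  have finM: "finite (carrier ?M)" using fin carM by simp
  \<comment> \<open>A coset meeting both \<open>X\<close> and \<open>Y\<close> makes
    \<open>Y\<close> meet \<open>L <#> X\<close>, which is a union of blocks and therefore contains
    \<open>Y\<close>. Used in both directions, this shows that images of blocks are equal or
    disjoint.\<close>
  have sub: "?\<pi> ` Y \<subseteq> ?\<pi> ` X"
    if "X \<in> P" "Y \<in> P" "x \<in> X" "y \<in> Y" "?\<pi> x = ?\<pi> y" for X Y x y
  proof
    note XY = s_partition_subset[OF P that(1)] s_partition_subset[OF P that(2)]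
    have "y \<in> ?\<pi> x" using that XY rcos_self[OF _ L.subgroup_axioms, of y] by auto
    then have "y \<in> L <#> X" using that by (auto simp: r_coset_def set_mult_def)
    moreover have "union_of_blocks P (L <#> X)"
      using set_mult_union_of_blocks[OF fin P L(2) block_union_of_blocks[OF part that(1)]] .
    ultimately have Y: "Y \<subseteq> L <#> X" using that unfolding union_of_blocks_def by blast
    fix C assume "C \<in> ?\<pi> ` Y"
    then obtain z where z: "z \<in> Y" "C = ?\<pi> z" by blast
    then obtain l w where lw: "l \<in> L" "w \<in> X" "z = l \<otimes> w" using Y by (auto simp: set_mult_def)
    then have "z \<in> ?\<pi> w" by (auto simp: r_coset_def)
    then have "?\<pi> w = ?\<pi> z"
      using repr_independence[OF _ _ L.subgroup_axioms] lw XY by blast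
    then show "C \<in> ?\<pi> ` X" using z lw by auto
  qed
  have "disjoint ?P"
  proof (rule disjointI)
    fix A B assume "A \<in> ?P" "B \<in> ?P" and ne: "A \<noteq> B"
    then obtain X Y where XY: "X \<in> P" "Y \<in> P" "A = ?\<pi> ` X" "B = ?\<pi> ` Y" by blast
    show "A \<inter> B = {}"
    proof (rule ccontr)
      assume "A \<inter> B \<noteq> {}"
      then obtain x y where "x \<in> X" "y \<in> Y" "?\<pi> x = ?\<pi> y" using XY by blast
      then have "A = B" using sub[of X Y x y] sub[of Y X y x] XY by auto
      then show False using ne by blast
    qed
  qed
  moreover have "\<Union>?P = carrier ?M"
    by (simp add: carM s_partition_Union[OF P, symmetric] image_Union)
  moreover have "{} \<notin> ?P" using part by (auto simp: partition_on_def)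
  ultimately have partM: "partition_on (carrier ?M) ?P" by (simp add: partition_on_def)
  have lift: "(\<lambda>g. if g \<in> carrier G then a (?\<pi> g) else 0) \<in> int_span P"
    if "a \<in> int_span ?P" for a
  proof -
    have "a (?\<pi> x) = a (?\<pi> y)" if "X \<in> P" "x \<in> X" "y \<in> X" for X x y
      using int_span_block_const[OF partM \<open>a \<in> int_span ?P\<close>, of "?\<pi> ` X"] that by blast
    moreover have "x \<in> carrier G" if "X \<in> P" "x \<in> X" for X x
      using s_partition_subset[OF P that(1)] that(2) by blast
    ultimately show ?thesis
      unfolding int_span_iff[OF fin part] by (intro conjI allI impI ballI) (simp, metis)
  qed
  have conv: "a \<otimes>\<^bsub>group_ring ?M\<^esub> b \<in> int_span ?P" if ab: "a \<in> int_span ?P" "b \<in> int_span ?P" for a b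
  proof -
    let ?a = "\<lambda>g. if g \<in> carrier G then a (?\<pi> g) else 0"
      and ?b = "\<lambda>g. if g \<in> carrier G then b (?\<pi> g) else 0"
    have eq: "(?a \<otimes>\<^bsub>group_ring G\<^esub> ?b) g = int (card L) * (a \<otimes>\<^bsub>group_ring ?M\<^esub> b) (?\<pi> g)"
      if g: "g \<in> carrier G" for g
    proof -
      have \<pi>g: "?\<pi> g \<in> carrier ?M" using g carM by auto
      let ?F = "\<lambda>C. a C * b (inv\<^bsub>?M\<^esub> C \<otimes>\<^bsub>?M\<^esub> ?\<pi> g)"
      have "(?a \<otimes>\<^bsub>group_ring G\<^esub> ?b) g = (\<Sum>h\<in>carrier G. ?F (?\<pi> h))"
        unfolding group_ring_mult_eq[OF g]
        by (intro sum.cong refl) (use g in \<open>simp del: mult_FactGroup add: \<pi>.hom_mult \<pi>.hom_inv\<close>)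
      \<comment> \<open>The summand depends only on the coset of \<open>h\<close>, and each coset
        has \<open>card L\<close> elements; this is the origin of the factor.\<close>
      also have "\<dots> = (\<Sum>C\<in>carrier ?M. \<Sum>h\<in>{h \<in> carrier G. ?\<pi> h = C}. ?F (?\<pi> h))"
        by (intro sum.group[symmetric]) (use fin finM carM in auto)
      also have "\<dots> = (\<Sum>C\<in>carrier ?M. int (card L) * ?F C)"
      proof (rule sum.cong[OF refl])
        fix C assume C: "C \<in> carrier ?M"
        then have "C \<in> rcosets L" by (simp add: FactGroup_def)
        have "{h \<in> carrier G. ?\<pi> h = C} = C"
        proof (intro subset_antisym subsetI)
          fix h assume "h \<in> {h \<in> carrier G. ?\<pi> h = C}"
          then show "h \<in> C" using rcos_self[OF _ L.subgroup_axioms] by blast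
        next
          fix h assume h: "h \<in> C"
          obtain c where c: "c \<in> carrier G" "C = ?\<pi> c" using C carM by auto
          then have "?\<pi> c = ?\<pi> h"
            using repr_independence[OF _ _ L.subgroup_axioms] h by blast
          moreover have "h \<in> carrier G" using h c r_coset_subset_G[OF L.subset] by blast
          ultimately show "h \<in> {h \<in> carrier G. ?\<pi> h = C}" using c by simp
        qed
        then have "(\<Sum>h\<in>{h \<in> carrier G. ?\<pi> h = C}. ?F (?\<pi> h)) = (\<Sum>h\<in>C. ?F C)"
          by (intro sum.cong) auto
        also have "\<dots> = int (card C) * ?F C" by simp
        also have "card C = card L"
          using card_rcosets_equal[OF \<open>C \<in> rcosets L\<close> L.subset] by simp
        finally show "(\<Sum>h\<in>{h \<in> carrier G. ?\<pi> h = C}. ?F (?\<pi> h)) = int (card L) * ?F C" .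
      qed
      also have "\<dots> = int (card L) * (a \<otimes>\<^bsub>group_ring ?M\<^esub> b) (?\<pi> g)"
        unfolding M.group_ring_mult_eq[OF \<pi>g] by (simp add: sum_distrib_left)
      finally show ?thesis .
    qed
    have "?a \<otimes>\<^bsub>group_ring G\<^esub> ?b \<in> int_span P"
      using lift[OF ab(1)] lift[OF ab(2)] P by (auto simp: s_partition_def)
    note const0 = int_span_block_const[OF part this]
    \<comment> \<open>Positivity allows the factor to be cancelled over the integers.\<close>
    have "card L > 0"
      using L.one_closed finite_subset[OF L.subset fin] card_gt_0_iff by blast
    have const: "(a \<otimes>\<^bsub>group_ring ?M\<^esub> b) (?\<pi> x) = (a \<otimes>\<^bsub>group_ring ?M\<^esub> b) (?\<pi> y)"
      if "X \<in> P" "x \<in> X" "y \<in> X" for X x y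
    proof -
      have xy: "x \<in> carrier G" "y \<in> carrier G"
        using s_partition_subset[OF P that(1)] that(2,3) by blast+
      show ?thesis
        using const0[OF that] \<open>card L > 0\<close> unfolding eq[OF xy(1)] eq[OF xy(2)] mult_cancel_left
        by linarith
    qed
    show ?thesis
      unfolding int_span_iff[OF finM partM]
    proof (intro conjI allI impI)
      show "\<forall>X\<in>?P. \<forall>x\<in>X. \<forall>y\<in>X. (a \<otimes>\<^bsub>group_ring ?M\<^esub> b) x = (a \<otimes>\<^bsub>group_ring ?M\<^esub> b) y"
      proof (intro ballI)
        fix B c d assume "B \<in> ?P" "c \<in> B" "d \<in> B"
        then obtain X x y where X: "X \<in> P" "x \<in> X" "y \<in> X" and cd: "c = ?\<pi> x" "d = ?\<pi> y"
          by blast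
        show "(a \<otimes>\<^bsub>group_ring ?M\<^esub> b) c = (a \<otimes>\<^bsub>group_ring ?M\<^esub> b) d"
          unfolding cd by (rule const[OF X])
      qed
    qed (rule M.group_ring_mult_outside)
  qed
  have "m_inv ?M ` A \<in> ?P" if A: "A \<in> ?P" for A
  proof -
    obtain X where X: "X \<in> P" "A = ?\<pi> ` X" using A by blast
    have "m_inv ?M ` ?\<pi> ` X = ?\<pi> ` (m_inv G ` X)"
      unfolding image_image using s_partition_subset[OF P X(1)]
      by (intro image_cong refl) (metis \<pi>.hom_inv subsetD)
    then show ?thesis using X P by (auto simp: s_partition_def)
  qed
  moreover have "{\<one>\<^bsub>?M\<^esub>} \<in> ?P"
  proof -
    have "{\<one>\<^bsub>?M\<^esub>} = ?\<pi> ` {\<one>}" using L.subset by simp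
    then show ?thesis using P unfolding s_partition_def by blast
  qed
  ultimately show ?thesis
    unfolding s_partition_def by (intro conjI ballI partM conv)
qed

section \<open>Group automorphisms acting on S-rings\<close>

lemma (in group) auto_group_hom: "\<sigma> \<in> auto G \<Longrightarrow> group_hom G G \<sigma>"
  by unfold_locales (auto simp: auto_def)

lemma auto_bij_betw: "\<sigma> \<in> auto G \<Longrightarrow> bij_betw \<sigma> (carrier G) (carrier G)"
  by (auto simp: auto_def Bij_def)

lemma (in group) auto_compose:
  assumes "\<sigma> \<in> auto G" "\<tau> \<in> auto G"
  shows "compose (carrier G) \<sigma> \<tau> \<in> auto G"
  using assms compose_Bij
  by (auto simp: auto_def hom_def compose_def Pi_iff)

lemma (in group) auto_inverse:
  assumes "\<sigma> \<in> auto G"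
  obtains \<sigma>' where "\<sigma>' \<in> auto G" "\<And>x. x \<in> carrier G \<Longrightarrow> \<sigma>' (\<sigma> x) = x"
    "\<And>x. x \<in> carrier G \<Longrightarrow> \<sigma> (\<sigma>' x) = x"
proof -
  let ?s = "restrict (inv_into (carrier G) \<sigma>) (carrier G)"
  have b: "bij_betw \<sigma> (carrier G) (carrier G)" using auto_bij_betw[OF assms] .
  have "?s \<in> auto G"
    using assms restrict_inv_into_hom restrict_inv_into_Bij by (auto simp: auto_def)
  moreover have "?s (\<sigma> x) = x" "\<sigma> (?s x) = x" if "x \<in> carrier G" for x
    using that b bij_betwE[OF b]
    by (auto simp: bij_betw_inv_into_left bij_betw_inv_into_right)
  ultimately show thesis using that by blast
qed

text \<open>Convolution commutes with pulling functions back along \<open>\<sigma>\<close>, so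
  closure of the image partition is tested on \<open>P\<close> itself.\<close>

lemma (in group) s_partition_auto_image:
  assumes fin: "finite (carrier G)" and P: "s_partition G P" and \<sigma>: "\<sigma> \<in> auto G"
  shows "s_partition G ((`) \<sigma> ` P)"
proof -
  interpret \<sigma>: group_hom G G \<sigma> by (rule auto_group_hom[OF \<sigma>])
  have b: "bij_betw \<sigma> (carrier G) (carrier G)" using auto_bij_betw[OF \<sigma>] .
  note part = s_partition_partition[OF P]
  have sub: "X \<subseteq> carrier G" if "X \<in> P" for X using s_partition_subset[OF P that] .
  let ?P = "(`) \<sigma> ` P"
  have part': "partition_on (carrier G) ?P"
  proof -
    have "{} \<notin> ?P" using part by (auto simp: partition_on_def)
    then show ?thesis
      using partition_on_inj_image[OF part, of \<sigma>] b by (simp add: bij_betw_def)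
  qed
  have lift: "(\<lambda>g. if g \<in> carrier G then a (\<sigma> g) else 0) \<in> int_span P"
    if "a \<in> int_span ?P" for a
  proof -
    have "a (\<sigma> x) = a (\<sigma> y)" if "X \<in> P" "x \<in> X" "y \<in> X" for X x y
      using int_span_block_const[OF part' \<open>a \<in> int_span ?P\<close>, of "\<sigma> ` X"] that by blast
    moreover have "x \<in> carrier G" if "X \<in> P" "x \<in> X" for X x
      using sub[OF that(1)] that(2) by blast
    ultimately show ?thesis
      unfolding int_span_iff[OF fin part] by (intro conjI allI impI ballI) (simp, metis)
  qed
  have conv: "a \<otimes>\<^bsub>group_ring G\<^esub> b \<in> int_span ?P" if ab: "a \<in> int_span ?P" "b \<in> int_span ?P" for a b
  proof -
    let ?a = "\<lambda>g. if g \<in> carrier G then a (\<sigma> g) else 0"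
      and ?b = "\<lambda>g. if g \<in> carrier G then b (\<sigma> g) else 0"
    have eq: "(?a \<otimes>\<^bsub>group_ring G\<^esub> ?b) g = (a \<otimes>\<^bsub>group_ring G\<^esub> b) (\<sigma> g)"
      if g: "g \<in> carrier G" for g
    proof -
      have "(?a \<otimes>\<^bsub>group_ring G\<^esub> ?b) g = (\<Sum>h\<in>carrier G. a (\<sigma> h) * b (inv (\<sigma> h) \<otimes> \<sigma> g))"
        unfolding group_ring_mult_eq[OF g] by (intro sum.cong refl) (use g in simp)
      also have "\<dots> = (\<Sum>h\<in>carrier G. a h * b (inv h \<otimes> \<sigma> g))"
        by (rule sum.reindex_bij_betw[OF b])
      also have "\<dots> = (a \<otimes>\<^bsub>group_ring G\<^esub> b) (\<sigma> g)"
        using g by (simp add: group_ring_mult_eq)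
      finally show ?thesis .
    qed
    have "?a \<otimes>\<^bsub>group_ring G\<^esub> ?b \<in> int_span P"
      using lift[OF ab(1)] lift[OF ab(2)] P by (auto simp: s_partition_def)
    note const0 = int_span_block_const[OF part this]
    have const: "(a \<otimes>\<^bsub>group_ring G\<^esub> b) (\<sigma> x) = (a \<otimes>\<^bsub>group_ring G\<^esub> b) (\<sigma> y)"
      if "X \<in> P" "x \<in> X" "y \<in> X" for X x y
    proof -
      have xy: "x \<in> carrier G" "y \<in> carrier G"
        using sub[OF that(1)] that(2,3) by blast+
      show ?thesis
        using const0[OF that] unfolding eq[OF xy(1)] eq[OF xy(2)] .
    qed
    show ?thesis
      unfolding int_span_iff[OF fin part']
    proof (intro conjI allI impI)
      show "\<forall>X\<in>?P. \<forall>x\<in>X. \<forall>y\<in>X. (a \<otimes>\<^bsub>group_ring G\<^esub> b) x = (a \<otimes>\<^bsub>group_ring G\<^esub> b) y"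
      proof (intro ballI)
        fix B c d assume "B \<in> ?P" "c \<in> B" "d \<in> B"
        then obtain X x y where X: "X \<in> P" "x \<in> X" "y \<in> X" and cd: "c = \<sigma> x" "d = \<sigma> y"
          by blast
        show "(a \<otimes>\<^bsub>group_ring G\<^esub> b) c = (a \<otimes>\<^bsub>group_ring G\<^esub> b) d"
          unfolding cd by (rule const[OF X])
      qed
    qed (rule group_ring_mult_outside)
  qed
  have "m_inv G ` A \<in> ?P" if A: "A \<in> ?P" for A
  proof -
    obtain X where X: "X \<in> P" "A = \<sigma> ` X" using A by blast
    have "m_inv G ` \<sigma> ` X = \<sigma> ` (m_inv G ` X)"
      unfolding image_image using sub[OF X(1)]
      by (intro image_cong refl) (metis \<sigma>.hom_inv subsetD)
    then show ?thesis using X P by (auto simp: s_partition_def)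
  qed
  moreover have "{\<one>} \<in> ?P"
  proof -
    have "{\<one>} = \<sigma> ` {\<one>}" by simp
    then show ?thesis using P unfolding s_partition_def by blast
  qed
  ultimately show ?thesis
    unfolding s_partition_def by (intro conjI ballI part' conv)
qed

section \<open>Isomorphisms and the CI property\<close>

text \<open>The relations \<open>Rel\<close> depend only on such quotients, so right translations
  preserve all of them.\<close>

lemma (in group) right_translation_quotient:
  assumes "x \<in> carrier G" "y \<in> carrier G" "c \<in> carrier G"
  shows "x \<otimes> inv c \<otimes> inv (y \<otimes> inv c) = x \<otimes> inv y"
proof -
  have "inv c \<otimes> (c \<otimes> inv y) = inv y" using assms by (simp add: m_assoc[symmetric])
  then show ?thesis using assms by (simp add: inv_mult_group m_assoc)
qed

lemma (in group) Rel_iff: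
  assumes "X \<subseteq> carrier G"
  shows "(g, h) \<in> Rel G X \<longleftrightarrow> g \<in> carrier G \<and> h \<in> carrier G \<and> h \<otimes> inv g \<in> X"
proof
  assume "(g, h) \<in> Rel G X"
  then obtain x where x: "g \<in> carrier G" "x \<in> X" "h = x \<otimes> g" by (auto simp: Rel_def)
  then have "x \<in> carrier G" using assms by auto
  then show "g \<in> carrier G \<and> h \<in> carrier G \<and> h \<otimes> inv g \<in> X"
    using x by (simp add: m_assoc)
next
  assume *: "g \<in> carrier G \<and> h \<in> carrier G \<and> h \<otimes> inv g \<in> X"
  then have "h = (h \<otimes> inv g) \<otimes> g" by (simp add: m_assoc)
  then show "(g, h) \<in> Rel G X" using * unfolding Rel_def by blast
qed

text \<open>By surjectivity every pair over the carrier has the form \<open>(f g, f h)\<close>, and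
  by injectivity \<open>g\<close> and \<open>h\<close> are recovered from it, so equality of
  relations can be tested at such pairs.\<close>

lemma (in group) rel_image_Rel_eq_iff:
  assumes f: "bij_betw f (carrier G) (carrier G)" and X: "X \<subseteq> carrier G" and Y: "Y \<subseteq> carrier G"
  shows "rel_image f (Rel G X) = Rel G Y \<longleftrightarrow>
    (\<forall>g\<in>carrier G. \<forall>h\<in>carrier G. h \<otimes> inv g \<in> X \<longleftrightarrow> f h \<otimes> inv (f g) \<in> Y)"
    (is "?l \<longleftrightarrow> ?r")
proof -
  have inj: "f x = f y \<longleftrightarrow> x = y" if "x \<in> carrier G" "y \<in> carrier G" for x y
    using f that by (auto simp: bij_betw_def inj_on_def)
  have fc: "f x \<in> carrier G" if "x \<in> carrier G" for x
    using f that bij_betwE by blast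
  have surj: "\<exists>x\<in>carrier G. z = f x" if "z \<in> carrier G" for z
    using f that by (auto simp: bij_betw_def)
  have mem: "(f g, f h) \<in> rel_image f (Rel G X) \<longleftrightarrow> h \<otimes> inv g \<in> X"
    if "g \<in> carrier G" "h \<in> carrier G" for g h
    using that unfolding rel_image_def by (auto simp: Rel_iff[OF X] inj)
  have dom: "\<exists>g\<in>carrier G. \<exists>h\<in>carrier G. p = (f g, f h)"
    if "p \<in> rel_image f (Rel G X) \<or> p \<in> Rel G Y" for p
    using that
  proof
    assume "p \<in> rel_image f (Rel G X)"
    then show ?thesis unfolding rel_image_def by (auto simp: Rel_iff[OF X])
  next
    assume "p \<in> Rel G Y"
    then have "fst p \<in> carrier G" "snd p \<in> carrier G"
      by (cases p, simp add: Rel_iff[OF Y])+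
    then obtain g h where "g \<in> carrier G" "fst p = f g" "h \<in> carrier G" "snd p = f h"
      using surj by blast
    then show ?thesis by (metis prod.collapse)
  qed
  show ?thesis
  proof
    assume ?l
    then show ?r using mem fc by (auto simp: Rel_iff[OF Y])
  next
    assume r: ?r
    show ?l
    proof (rule Set.set_eqI)
      fix p
      show "p \<in> rel_image f (Rel G X) \<longleftrightarrow> p \<in> Rel G Y"
      proof (cases "\<exists>g\<in>carrier G. \<exists>h\<in>carrier G. p = (f g, f h)")
        case True
        then obtain g h where gh: "g \<in> carrier G" "h \<in> carrier G" "p = (f g, f h)" by blast
        then show ?thesis
          using r mem[OF gh(1,2)] fc by (simp add: Rel_iff[OF Y])
      next
        case False
        then show ?thesis using dom[of p] by blast
      qed
    qed
  qed
qed

text \<open>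
  An isomorphism fixing the identity: comparing the neighbours of \<open>\<one>\<close> shows that it can only carry
  the relation of \<open>X\<close> to that of \<open>f ` X\<close>.
\<close>

definition cayley_iso :: "('a, 'm) monoid_scheme \<Rightarrow> 'a set set \<Rightarrow> ('a \<Rightarrow> 'a) \<Rightarrow> bool"
  where "cayley_iso G P f \<longleftrightarrow>
    bij_betw f (carrier G) (carrier G) \<and> f \<one>\<^bsub>G\<^esub> = \<one>\<^bsub>G\<^esub> \<and>
    (\<forall>X\<in>P. \<forall>g\<in>carrier G. \<forall>h\<in>carrier G.
      h \<otimes>\<^bsub>G\<^esub> inv\<^bsub>G\<^esub> g \<in> X \<longleftrightarrow> f h \<otimes>\<^bsub>G\<^esub> inv\<^bsub>G\<^esub> (f g) \<in> f ` X)"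

lemma cayley_iso_union_of_blocks:
  assumes f: "cayley_iso G P f" and W: "union_of_blocks P W"
    and gh: "g \<in> carrier G" "h \<in> carrier G"
  shows "h \<otimes>\<^bsub>G\<^esub> inv\<^bsub>G\<^esub> g \<in> W \<longleftrightarrow> f h \<otimes>\<^bsub>G\<^esub> inv\<^bsub>G\<^esub> (f g) \<in> f ` W"
proof
  assume "h \<otimes>\<^bsub>G\<^esub> inv\<^bsub>G\<^esub> g \<in> W"
  then obtain X where X: "X \<in> P" "h \<otimes>\<^bsub>G\<^esub> inv\<^bsub>G\<^esub> g \<in> X" "X \<subseteq> W"
    using union_of_blocksE[OF W] by blast
  then have "f h \<otimes>\<^bsub>G\<^esub> inv\<^bsub>G\<^esub> (f g) \<in> f ` X" using f gh unfolding cayley_iso_def by blast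
  then show "f h \<otimes>\<^bsub>G\<^esub> inv\<^bsub>G\<^esub> (f g) \<in> f ` W" using X by blast
next
  assume "f h \<otimes>\<^bsub>G\<^esub> inv\<^bsub>G\<^esub> (f g) \<in> f ` W"
  then obtain w where w: "w \<in> W" "f h \<otimes>\<^bsub>G\<^esub> inv\<^bsub>G\<^esub> (f g) = f w" by blast
  then obtain X where X: "X \<in> P" "w \<in> X" "X \<subseteq> W"
    using union_of_blocksE[OF W] by blast
  then have "f h \<otimes>\<^bsub>G\<^esub> inv\<^bsub>G\<^esub> (f g) \<in> f ` X" using w by blast
  then have "h \<otimes>\<^bsub>G\<^esub> inv\<^bsub>G\<^esub> g \<in> X" using f gh X(1) unfolding cayley_iso_def by blast
  then show "h \<otimes>\<^bsub>G\<^esub> inv\<^bsub>G\<^esub> g \<in> W" using X by blast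
qed

lemma union_of_blocks_image:
  assumes "inj_on f (\<Union>P)" "union_of_blocks P W"
  shows "union_of_blocks ((`) f ` P) (f ` W)"
  unfolding union_of_blocks_def
proof (intro conjI ballI)
  have W: "W \<subseteq> \<Union>P" using assms(2) by (simp add: union_of_blocks_def)
  then show "f ` W \<subseteq> \<Union>((`) f ` P)"
    unfolding image_Union[symmetric] by (rule image_mono)
  fix Y assume "Y \<in> (`) f ` P"
  then obtain X where X: "X \<in> P" "Y = f ` X" by blast
  from assms(2) X(1) have "X \<subseteq> W \<or> X \<inter> W = {}" by (simp add: union_of_blocks_def)
  moreover have "f ` (X \<inter> W) = f ` X \<inter> f ` W"
    by (rule inj_on_image_Int[OF assms(1)]) (use X W in auto)
  ultimately show "Y \<subseteq> f ` W \<or> Y \<inter> f ` W = {}" using X(2) by auto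
qed

text \<open>Only quotients are respected by \<open>f\<close>, so both closure properties are phrased
  through them: an inverse compares \<open>w\<close> with the identity, and a product is treated by
  first solving \<open>f u = f v \<otimes> f w\<close>, which turns \<open>f v\<close> into a
  quotient.\<close>

lemma (in group) cayley_iso_image_subgroup:
  assumes f: "cayley_iso G P f" and W: "subgroup W G" "union_of_blocks P W"
  shows "subgroup (f ` W) G"
proof -
  interpret W: subgroup W G by (rule W)
  note iff = cayley_iso_union_of_blocks[OF f W(2)]
  have f1: "f \<one> = \<one>" and b: "bij_betw f (carrier G) (carrier G)"
    using f by (auto simp: cayley_iso_def)
  have fc: "f x \<in> carrier G" if "x \<in> carrier G" for x
    using b that bij_betwE by blast
  show ?thesis
  proof (rule subgroupI)
    show "f ` W \<subseteq> carrier G" using fc W.subset by blast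
    show "f ` W \<noteq> {}" using W.one_closed by blast
  next
    fix y assume "y \<in> f ` W"
    then obtain w where w: "w \<in> W" "y = f w" by blast
    then have wc: "w \<in> carrier G" using W.subset by blast
    have "\<one> \<otimes> inv w \<in> W" using w W.subset by auto
    then have "f \<one> \<otimes> inv (f w) \<in> f ` W" using iff[of w \<one>] wc by blast
    then show "inv y \<in> f ` W" using f1 w fc[OF wc] by simp
  next
    fix y z assume "y \<in> f ` W" "z \<in> f ` W"
    then obtain v w where vw: "v \<in> W" "y = f v" "w \<in> W" "z = f w" by blast
    then have c: "v \<in> carrier G" "w \<in> carrier G" using W.subset by blast+
    then have fvc: "f v \<in> carrier G" "f w \<in> carrier G" using fc by auto
    have "f v \<otimes> f w \<in> f ` carrier G"
      using b fvc by (simp add: bij_betw_def)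
    then obtain u where u: "u \<in> carrier G" "f u = f v \<otimes> f w" by force
    have "f u \<otimes> inv (f w) = f v" using u fvc by (simp add: m_assoc)
    then have "f u \<otimes> inv (f w) \<in> f ` W" using vw by auto
    then have "u \<otimes> inv w \<in> W" using iff[of w u] u c by simp
    then have "(u \<otimes> inv w) \<otimes> w \<in> W" using vw by auto
    then have "u \<in> W" using u c by (simp add: m_assoc)
    then show "y \<otimes> z \<in> f ` W" using vw u by force
  qed
qed

text \<open>The coset of \<open>g\<close> consists of those \<open>h\<close> whose quotient by
  \<open>g\<close> lies in \<open>W\<close>, and that relation is respected by
  \<open>f\<close>.\<close>

lemma (in group) cayley_iso_image_coset:
  assumes f: "cayley_iso G P f" and W: "subgroup W G" "union_of_blocks P W" and g: "g \<in> carrier G"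
  shows "f ` (W #> g) = f ` W #> f g"
proof -
  interpret W: subgroup W G by (rule W)
  interpret fW: subgroup "f ` W" G by (rule cayley_iso_image_subgroup[OF f W])
  note iff = cayley_iso_union_of_blocks[OF f W(2)]
  have b: "bij_betw f (carrier G) (carrier G)"
    using f by (auto simp: cayley_iso_def)
  have fc: "f x \<in> carrier G" if "x \<in> carrier G" for x
    using b that bij_betwE by blast
  show ?thesis
  proof (intro subset_antisym subsetI)
    fix y assume "y \<in> f ` (W #> g)"
    then obtain h where h: "h \<in> W #> g" "y = f h" by blast
    then have hc: "h \<in> carrier G" using r_coset_subset_G[OF W.subset g] by blast
    then have "h \<otimes> inv g \<in> W" using W.rcos_module[OF is_group g hc] h by simp
    then show "y \<in> f ` W #> f g"
      using iff[OF g hc] fW.rcos_module[OF is_group fc[OF g] fc[OF hc]] h by simp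
  next
    fix y assume y: "y \<in> f ` W #> f g"
    then have "y \<in> f ` carrier G"
      using r_coset_subset_G[OF fW.subset fc[OF g]] b by (auto simp: bij_betw_def)
    then obtain h where h: "h \<in> carrier G" "y = f h" by blast
    then have "f h \<otimes> inv (f g) \<in> f ` W"
      using fW.rcos_module[OF is_group fc[OF g] fc[OF h(1)]] y by simp
    then have "h \<in> W #> g"
      using iff[OF g h(1)] W.rcos_module[OF is_group g h(1)] by simp
    then show "y \<in> f ` (W #> g)" using h by blast
  qed
qed

lemma (in group) cayley_iso_auto_compose:
  assumes f: "cayley_iso G P f" and P: "\<And>X. X \<in> P \<Longrightarrow> X \<subseteq> carrier G" and \<theta>: "\<theta> \<in> auto G"
  shows "cayley_iso G P (\<theta> \<circ> f)"
proof -
  interpret \<theta>: group_hom G G \<theta> by (rule auto_group_hom[OF \<theta>])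
  have b: "bij_betw \<theta> (carrier G) (carrier G)" using auto_bij_betw[OF \<theta>] .
  have fb: "bij_betw f (carrier G) (carrier G)" and f1: "f \<one> = \<one>"
    using f by (auto simp: cayley_iso_def)
  have fc: "f x \<in> carrier G" if "x \<in> carrier G" for x
    using fb that bij_betwE by blast
  have "h \<otimes> inv g \<in> X \<longleftrightarrow> \<theta> (f h) \<otimes> inv (\<theta> (f g)) \<in> (\<theta> \<circ> f) ` X"
    if X: "X \<in> P" and gh: "g \<in> carrier G" "h \<in> carrier G" for X g h
  proof -
    have "\<theta> (f h) \<otimes> inv (\<theta> (f g)) = \<theta> (f h \<otimes> inv (f g))"
      using fc gh by simp
    moreover have "f ` X \<subseteq> carrier G" using fc P[OF X] by blast
    moreover have "f h \<otimes> inv (f g) \<in> carrier G" using fc gh by simp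
    ultimately have "\<theta> (f h) \<otimes> inv (\<theta> (f g)) \<in> \<theta> ` f ` X \<longleftrightarrow> f h \<otimes> inv (f g) \<in> f ` X"
      using inj_on_image_mem_iff[of \<theta> "carrier G"] b by (simp add: bij_betw_def)
    then show ?thesis
      using f X gh unfolding cayley_iso_def image_comp by blast
  qed
  then show ?thesis
    unfolding cayley_iso_def using bij_betw_trans[OF fb b] f1 by simp
qed

section \<open>Automorphisms, isomorphisms and the CI criterion on basic sets\<close>

lemma (in group) Aut_sring_iff:
  assumes fin: "finite (carrier G)" and P: "s_partition G P"
  shows "f \<in> Aut_sring G (int_span P) \<longleftrightarrow> f \<in> Bij (carrier G) \<and>
    (\<forall>X\<in>P. \<forall>g\<in>carrier G. \<forall>h\<in>carrier G. h \<otimes> inv g \<in> X \<longleftrightarrow> f h \<otimes> inv (f g) \<in> X)"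
proof -
  have "rel_image f (Rel G X) = Rel G X \<longleftrightarrow>
      (\<forall>g\<in>carrier G. \<forall>h\<in>carrier G. h \<otimes> inv g \<in> X \<longleftrightarrow> f h \<otimes> inv (f g) \<in> X)"
    if "f \<in> Bij (carrier G)" "X \<in> P" for X
    using that s_partition_subset[OF P that(2)]
    by (intro rel_image_Rel_eq_iff) (auto simp: Bij_def)
  then show ?thesis
    unfolding Aut_sring_def basic_sets_s_partition[OF fin P] mem_Collect_eq
    by (intro conj_cong refl ball_cong)
qed

text \<open>For a homomorphism the quotient of the images is the image of the quotient, so
  preserving the relation of \<open>X\<close> means mapping \<open>X\<close> onto itself.\<close>

lemma (in group) Aut_grp_sring_iff:
  assumes fin: "finite (carrier G)" and P: "s_partition G P"
  shows "f \<in> Aut_grp_sring G (int_span P) \<longleftrightarrow> f \<in> auto G \<and> (\<forall>X\<in>P. f ` X = X)"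
proof (cases "f \<in> auto G")
  case True
  interpret f: group_hom G G f by (rule auto_group_hom[OF True])
  have b: "bij_betw f (carrier G) (carrier G)" using auto_bij_betw[OF True] .
  have "f ` X = X \<longleftrightarrow>
      (\<forall>g\<in>carrier G. \<forall>h\<in>carrier G. h \<otimes> inv g \<in> X \<longleftrightarrow> f h \<otimes> inv (f g) \<in> X)"
    if X: "X \<in> P" for X
  proof
    have XG: "X \<subseteq> carrier G" by (rule s_partition_subset[OF P X])
    assume eq: "f ` X = X"
    show "\<forall>g\<in>carrier G. \<forall>h\<in>carrier G. h \<otimes> inv g \<in> X \<longleftrightarrow> f h \<otimes> inv (f g) \<in> X"
    proof (intro ballI)
      fix g h assume gh: "g \<in> carrier G" "h \<in> carrier G"
      have "f (h \<otimes> inv g) \<in> f ` X \<longleftrightarrow> h \<otimes> inv g \<in> X"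
        using inj_on_image_mem_iff[of f "carrier G" "h \<otimes> inv g" X] b XG gh by (simp add: bij_betw_def)
      then show "h \<otimes> inv g \<in> X \<longleftrightarrow> f h \<otimes> inv (f g) \<in> X"
        using gh eq by simp
    qed
  next
    have XG: "X \<subseteq> carrier G" by (rule s_partition_subset[OF P X])
    assume *: "\<forall>g\<in>carrier G. \<forall>h\<in>carrier G. h \<otimes> inv g \<in> X \<longleftrightarrow> f h \<otimes> inv (f g) \<in> X"
    have mem: "h \<in> X \<longleftrightarrow> f h \<in> X" if "h \<in> carrier G" for h
      using *[rule_format, of \<one> h] that by simp
    show "f ` X = X"
    proof (intro subset_antisym subsetI)
      fix y assume "y \<in> f ` X"
      then show "y \<in> X" using mem XG by auto
    next
      fix y assume y: "y \<in> X"
      then obtain h where "h \<in> carrier G" "y = f h" using b XG by (auto simp: bij_betw_def)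
      then show "y \<in> f ` X" using mem y by blast
    qed
  qed
  then show ?thesis
    using True unfolding Aut_grp_sring_def Int_iff Aut_sring_iff[OF fin P] by (auto simp: auto_def)
next
  case False
  then show ?thesis by (simp add: Aut_grp_sring_def)
qed

lemma (in group) Iso_sringI:
  assumes fin: "finite (carrier G)" and P: "s_partition G P" and f: "f \<in> Bij (carrier G)"
    and P': "s_partition G (\<Phi> ` P)"
    and iff: "\<And>X g h. X \<in> P \<Longrightarrow> g \<in> carrier G \<Longrightarrow> h \<in> carrier G \<Longrightarrow>
      h \<otimes> inv g \<in> X \<longleftrightarrow> f h \<otimes> inv (f g) \<in> \<Phi> X"
  shows "f \<in> Iso_sring G (int_span P)"
proof -
  have b: "bij_betw f (carrier G) (carrier G)" using f by (auto simp: Bij_def)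
  have eq: "rel_image f (Rel G X) = Rel G (\<Phi> X)" if "X \<in> P" for X
    using iff that s_partition_subset[OF P that] s_partition_subset[OF P', of "\<Phi> X"]
    by (subst rel_image_Rel_eq_iff[OF b]) auto
  have "sring_iso G (int_span P) G (int_span (\<Phi> ` P)) f"
    unfolding sring_iso_def basic_sets_s_partition[OF fin P] basic_sets_s_partition[OF fin P']
    using b eq by (auto simp: image_iff)
  moreover have "s_ring G (int_span (\<Phi> ` P))"
    using s_ring_iff_s_partition[OF fin] P' by blast
  ultimately show ?thesis
    using f unfolding Iso_sring_def by blast
qed

text \<open>\<open>f0\<close> is \<open>f\<close> followed by the right translation that brings the
  identity back. Quotients, and with them the correspondence of relations, stay the same.\<close>

lemma (in group) Iso_sring_normalize:
  assumes fin: "finite (carrier G)" and P: "s_partition G P" and f: "f \<in> Iso_sring G (int_span P)"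
  defines "f0 \<equiv> \<lambda>x. f x \<otimes> inv (f \<one>)"
  shows "cayley_iso G P f0" and "s_partition G ((`) f0 ` P)"
proof -
  have b: "bij_betw f (carrier G) (carrier G)" using f by (auto simp: Iso_sring_def Bij_def)
  have fc: "f x \<in> carrier G" if "x \<in> carrier G" for x
    using b that bij_betwE by blast
  obtain A' where A': "s_ring G A'" "sring_iso G (int_span P) G A' f"
    using f by (auto simp: Iso_sring_def)
  obtain P' where P': "s_partition G P'" "A' = int_span P'"
    using A'(1) s_ring_iff_s_partition[OF fin] by blast
  have eq: "{rel_image f (Rel G X) | X. X \<in> P} = {Rel G X' | X'. X' \<in> P'}"
    using A'(2) unfolding P'(2) sring_iso_def basic_sets_s_partition[OF fin P]
      basic_sets_s_partition[OF fin P'(1)] by blast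
  have diff: "f0 h \<otimes> inv (f0 g) = f h \<otimes> inv (f g)" if "g \<in> carrier G" "h \<in> carrier G" for g h
    unfolding f0_def by (intro right_translation_quotient fc that one_closed)
  have b0: "bij_betw f0 (carrier G) (carrier G)"
  proof -
    have "bij_betw (\<lambda>y. y \<otimes> inv (f \<one>)) (carrier G) (carrier G)"
      by (rule bij_betwI[where g = "\<lambda>y. y \<otimes> f \<one>"]) (use fc in \<open>auto simp: m_assoc\<close>)
    from bij_betw_trans[OF b this] show ?thesis by (simp add: f0_def comp_def)
  qed
  have fc0: "f0 x \<in> carrier G" if "x \<in> carrier G" for x
    using b0 that bij_betwE by blast
  have key: "Y = f0 ` X \<and> (\<forall>g\<in>carrier G. \<forall>h\<in>carrier G. h \<otimes> inv g \<in> X \<longleftrightarrow> f h \<otimes> inv (f g) \<in> Y)"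
    if XY: "X \<in> P" "Y \<in> P'" "rel_image f (Rel G X) = Rel G Y" for X Y
  proof -
    have XG: "X \<subseteq> carrier G" and YG: "Y \<subseteq> carrier G"
      using s_partition_subset[OF P XY(1)] s_partition_subset[OF P'(1) XY(2)] .
    have iff: "\<forall>g\<in>carrier G. \<forall>h\<in>carrier G. h \<otimes> inv g \<in> X \<longleftrightarrow> f h \<otimes> inv (f g) \<in> Y"
      using XY(3) rel_image_Rel_eq_iff[OF b XG YG] by simp
    \<comment> \<open>Taking \<open>g\<close> to be the identity reads the target block off its
      relation.\<close>
    have mem: "h \<in> X \<longleftrightarrow> f0 h \<in> Y" if "h \<in> carrier G" for h
      using iff[rule_format, of \<one> h] that by (simp add: f0_def)
    have "Y = f0 ` X"
    proof (intro subset_antisym subsetI)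
      fix y assume y: "y \<in> Y"
      then obtain h where "h \<in> carrier G" "y = f0 h" using b0 YG by (auto simp: bij_betw_def)
      then show "y \<in> f0 ` X" using mem y by blast
    next
      fix y assume "y \<in> f0 ` X"
      then show "y \<in> Y" using mem XG by auto
    qed
    with iff show ?thesis by blast
  qed
  have X: "\<exists>Y\<in>P'. rel_image f (Rel G X) = Rel G Y" if "X \<in> P" for X
    using eq that by blast
  have Y: "\<exists>X\<in>P. rel_image f (Rel G X) = Rel G Y" if "Y \<in> P'" for Y
  proof -
    have "Rel G Y \<in> {rel_image f (Rel G X) | X. X \<in> P}" using eq that by blast
    then show ?thesis by force
  qed
  have iff: "h \<otimes> inv g \<in> X \<longleftrightarrow> f0 h \<otimes> inv (f0 g) \<in> f0 ` X"
    if XP: "X \<in> P" and gh: "g \<in> carrier G" "h \<in> carrier G" for X g h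
  proof -
    obtain Y where "Y \<in> P'" "rel_image f (Rel G X) = Rel G Y" using X[OF XP] by blast
    from key[OF XP this] show ?thesis using gh by (simp add: diff)
  qed
  moreover have "f0 \<one> = \<one>" using fc by (simp add: f0_def)
  ultimately show "cayley_iso G P f0" using b0 by (simp add: cayley_iso_def)
  have "(`) f0 ` P = P'"
  proof (intro subset_antisym subsetI)
    fix B assume "B \<in> (`) f0 ` P"
    then obtain Z where Z: "Z \<in> P" "B = f0 ` Z" by blast
    obtain W where W: "W \<in> P'" "rel_image f (Rel G Z) = Rel G W" using X[OF Z(1)] by blast
    show "B \<in> P'" using key[OF Z(1) W] W(1) Z(2) by simp
  next
    fix B assume B: "B \<in> P'"
    obtain Z where Z: "Z \<in> P" "rel_image f (Rel G Z) = Rel G B" using Y[OF B] by blast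
    show "B \<in> (`) f0 ` P" using key[OF Z(1) B Z(2)] Z(1) by blast
  qed
  then show "s_partition G ((`) f0 ` P)" using P' by simp
qed

lemma (in group) Aut_auto_prod_subset_Iso:
  assumes fin: "finite (carrier G)" and P: "s_partition G P"
  shows "perm_prod (carrier G) (Aut_sring G (int_span P)) (auto G) \<subseteq> Iso_sring G (int_span P)"
proof
  fix f assume "f \<in> perm_prod (carrier G) (Aut_sring G (int_span P)) (auto G)"
  then obtain a \<sigma> where f: "f = compose (carrier G) \<sigma> a" and a: "a \<in> Aut_sring G (int_span P)"
    and \<sigma>: "\<sigma> \<in> auto G"
    by (auto simp: perm_prod_def)
  interpret \<sigma>: group_hom G G \<sigma> by (rule auto_group_hom[OF \<sigma>])
  have b: "bij_betw \<sigma> (carrier G) (carrier G)" using auto_bij_betw[OF \<sigma>] .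
  have aB: "a \<in> Bij (carrier G)"
    and aX: "\<And>X g h. X \<in> P \<Longrightarrow> g \<in> carrier G \<Longrightarrow> h \<in> carrier G \<Longrightarrow>
        h \<otimes> inv g \<in> X \<longleftrightarrow> a h \<otimes> inv (a g) \<in> X"
    using a unfolding Aut_sring_iff[OF fin P] by blast+
  have ac: "a x \<in> carrier G" if "x \<in> carrier G" for x
    using Bij_imp_funcset[OF aB] that by blast
  show "f \<in> Iso_sring G (int_span P)"
  proof (rule Iso_sringI[OF fin P])
    show "f \<in> Bij (carrier G)"
      unfolding f using compose_Bij[OF _ aB] \<sigma> by (auto simp: auto_def)
    show "s_partition G ((`) \<sigma> ` P)" by (rule s_partition_auto_image[OF fin P \<sigma>])
    show "h \<otimes> inv g \<in> X \<longleftrightarrow> f h \<otimes> inv (f g) \<in> \<sigma> ` X"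
      if X: "X \<in> P" and gh: "g \<in> carrier G" "h \<in> carrier G" for X g h
    proof -
      have "f h \<otimes> inv (f g) = \<sigma> (a h \<otimes> inv (a g))"
        using gh ac by (simp add: f compose_eq)
      moreover have "\<sigma> (a h \<otimes> inv (a g)) \<in> \<sigma> ` X \<longleftrightarrow> a h \<otimes> inv (a g) \<in> X"
        using inj_on_image_mem_iff[of \<sigma> "carrier G" "a h \<otimes> inv (a g)" X] b s_partition_subset[OF P X] gh ac
        by (simp add: bij_betw_def)
      ultimately show ?thesis using aX[OF X gh] by simp
    qed
  qed
qed

text \<open>Writing \<open>f\<close> as \<open>a\<close> followed by \<open>\<sigma>\<close>, the
  factor \<open>a\<close> fixes the identity and so maps every block onto itself, leaving
  \<open>\<sigma>\<close> to act as \<open>f\<close> does. Conversely, equal action on blocks puts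
  \<open>\<sigma>^-1 f\<close> into \<open>Aut_sring\<close>.\<close>

lemma (in group) ci_sring_iff:
  assumes fin: "finite (carrier G)" and P: "s_partition G P"
  shows "ci_sring G (int_span P) \<longleftrightarrow>
    (\<forall>f. cayley_iso G P f \<and> s_partition G ((`) f ` P) \<longrightarrow> (\<exists>\<sigma>\<in>auto G. \<forall>X\<in>P. f ` X = \<sigma> ` X))"
    (is "?l \<longleftrightarrow> ?r")
proof
  assume ci: ?l
  show ?r
  proof (intro allI impI, elim conjE)
    fix f assume f: "cayley_iso G P f" and P': "s_partition G ((`) f ` P)"
    have b: "bij_betw f (carrier G) (carrier G)" and f1: "f \<one> = \<one>"
      using f by (auto simp: cayley_iso_def)
    let ?f = "restrict f (carrier G)"
    have "?f \<in> Iso_sring G (int_span P)"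
    proof (rule Iso_sringI[OF fin P _ P'])
      show "?f \<in> Bij (carrier G)"
        using b by (auto simp: Bij_def bij_betw_def inj_on_def)
      show "h \<otimes> inv g \<in> X \<longleftrightarrow> ?f h \<otimes> inv (?f g) \<in> f ` X"
        if "X \<in> P" "g \<in> carrier G" "h \<in> carrier G" for X g h
        using f that by (simp add: cayley_iso_def)
    qed
    then obtain a \<sigma> where fa: "?f = compose (carrier G) \<sigma> a"
      and a: "a \<in> Aut_sring G (int_span P)" and \<sigma>: "\<sigma> \<in> auto G"
      using ci unfolding ci_sring_def perm_prod_def by blast
    interpret \<sigma>: group_hom G G \<sigma> by (rule auto_group_hom[OF \<sigma>])
    have \<sigma>b: "bij_betw \<sigma> (carrier G) (carrier G)" using auto_bij_betw[OF \<sigma>] .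
    have aB: "a \<in> Bij (carrier G)"
      and aX: "\<And>X g h. X \<in> P \<Longrightarrow> g \<in> carrier G \<Longrightarrow> h \<in> carrier G \<Longrightarrow>
          h \<otimes> inv g \<in> X \<longleftrightarrow> a h \<otimes> inv (a g) \<in> X"
      using a unfolding Aut_sring_iff[OF fin P] by blast+
    have ab: "bij_betw a (carrier G) (carrier G)" using aB by (auto simp: Bij_def)
    have ac: "a x \<in> carrier G" if "x \<in> carrier G" for x
      using Bij_imp_funcset[OF aB] that by blast
    have fa': "f x = \<sigma> (a x)" if "x \<in> carrier G" for x
      using fun_cong[OF fa, of x] that by (simp add: compose_eq)
    have "\<sigma> (a \<one>) = \<sigma> \<one>" using fa'[of \<one>] f1 by simp
    then have a1: "a \<one> = \<one>"
      using \<sigma>b ac[of \<one>] by (auto simp: bij_betw_def inj_on_def)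
    have "f ` X = \<sigma> ` X" if X: "X \<in> P" for X
    proof -
      have XG: "X \<subseteq> carrier G" by (rule s_partition_subset[OF P X])
      have mem: "h \<in> X \<longleftrightarrow> a h \<in> X" if "h \<in> carrier G" for h
        using aX[OF X one_closed that] that ac a1 by simp
      have "a ` X = X"
      proof (intro subset_antisym subsetI)
        fix y assume "y \<in> a ` X"
        then show "y \<in> X" using mem XG by auto
      next
        fix y assume y: "y \<in> X"
        then obtain h where "h \<in> carrier G" "y = a h" using ab XG by (auto simp: bij_betw_def)
        then show "y \<in> a ` X" using mem y by blast
      qed
      moreover have "f ` X = \<sigma> ` a ` X"
        unfolding image_image using XG fa' by (intro image_cong) auto
      ultimately show ?thesis by simp
    qed
    then show "\<exists>\<sigma>\<in>auto G. \<forall>X\<in>P. f ` X = \<sigma> ` X" using \<sigma> by blast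
  qed
next
  assume r: ?r
  have "f \<in> perm_prod (carrier G) (Aut_sring G (int_span P)) (auto G)"
    if f: "f \<in> Iso_sring G (int_span P)" for f
  proof -
    define f0 where "f0 x = f x \<otimes> inv (f \<one>)" for x
    have f0: "cayley_iso G P f0" "s_partition G ((`) f0 ` P)"
      using Iso_sring_normalize[OF fin P f] unfolding f0_def .
    obtain \<sigma> where \<sigma>: "\<sigma> \<in> auto G" and \<sigma>X: "\<forall>X\<in>P. f0 ` X = \<sigma> ` X"
      using mp[OF spec[OF r] conjI[OF f0]] by (elim bexE)
    obtain \<sigma>' where \<sigma>': "\<sigma>' \<in> auto G" "\<And>x. x \<in> carrier G \<Longrightarrow> \<sigma>' (\<sigma> x) = x"
      "\<And>x. x \<in> carrier G \<Longrightarrow> \<sigma> (\<sigma>' x) = x"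
      using auto_inverse[OF \<sigma>] by blast
    interpret \<sigma>: group_hom G G \<sigma> by (rule auto_group_hom[OF \<sigma>])
    interpret \<sigma>': group_hom G G \<sigma>' by (rule auto_group_hom[OF \<sigma>'(1)])
    have fB: "f \<in> Bij (carrier G)" using f by (auto simp: Iso_sring_def)
    have fc: "f x \<in> carrier G" if "x \<in> carrier G" for x
      using Bij_imp_funcset[OF fB] that by blast
    \<comment> \<open>Built from \<open>f\<close>, not from \<open>f0\<close>: the right translation
      between them does not affect quotients and is absorbed into the factor from
      \<open>Aut_sring\<close>.\<close>
    let ?a = "compose (carrier G) \<sigma>' f"
    have aB: "?a \<in> Bij (carrier G)"
      using compose_Bij[OF _ fB] \<sigma>'(1) by (auto simp: auto_def)
    have "h \<otimes> inv g \<in> X \<longleftrightarrow> ?a h \<otimes> inv (?a g) \<in> X"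
      if X: "X \<in> P" and gh: "g \<in> carrier G" "h \<in> carrier G" for X g h
    proof -
      have XG: "X \<subseteq> carrier G" by (rule s_partition_subset[OF P X])
      have diff: "f0 h \<otimes> inv (f0 g) = f h \<otimes> inv (f g)"
        unfolding f0_def by (intro right_translation_quotient fc gh one_closed)
      have "h \<otimes> inv g \<in> X \<longleftrightarrow> f h \<otimes> inv (f g) \<in> \<sigma> ` X"
        using f0(1) X gh bspec[OF \<sigma>X X] diff unfolding cayley_iso_def by metis
      also have "\<dots> \<longleftrightarrow> \<sigma>' (f h \<otimes> inv (f g)) \<in> X"
      proof
        assume "f h \<otimes> inv (f g) \<in> \<sigma> ` X"
        then show "\<sigma>' (f h \<otimes> inv (f g)) \<in> X" using \<sigma>'(2) XG by auto
      next
        assume "\<sigma>' (f h \<otimes> inv (f g)) \<in> X"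
        moreover have "\<sigma> (\<sigma>' (f h \<otimes> inv (f g))) = f h \<otimes> inv (f g)"
          using gh fc by (intro \<sigma>'(3)) simp
        ultimately show "f h \<otimes> inv (f g) \<in> \<sigma> ` X" by (metis imageI)
      qed
      also have "\<sigma>' (f h \<otimes> inv (f g)) = ?a h \<otimes> inv (?a g)"
        using gh fc by (simp add: compose_eq)
      finally show ?thesis .
    qed
    then have "?a \<in> Aut_sring G (int_span P)"
      using aB unfolding Aut_sring_iff[OF fin P] by blast
    moreover have "f = compose (carrier G) \<sigma> ?a"
    proof (rule extensionalityI[of _ "carrier G"])
      show "f \<in> extensional (carrier G)" using fB by (simp add: Bij_def)
      show "f x = compose (carrier G) \<sigma> ?a x" if "x \<in> carrier G" for x
        using that fc \<sigma>'(3) by (simp add: compose_eq)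
    qed simp
    ultimately show ?thesis
      using \<sigma> unfolding perm_prod_def by blast
  qed
  then show ?l
    unfolding ci_sring_def using Aut_auto_prod_subset_Iso[OF fin P] by blast
qed

section \<open>Wreath products\<close>

lemma set_mult_eq_Union_cosets: "L <#>\<^bsub>G\<^esub> X = \<Union>((#>\<^bsub>G\<^esub>) L ` X)"
  by (auto simp: set_mult_def r_coset_def)

lemma (in group) auto_image_coset:
  assumes "\<sigma> \<in> auto G" "L \<subseteq> carrier G" "g \<in> carrier G"
  shows "\<sigma> ` (L #> g) = \<sigma> ` L #> \<sigma> g"
proof -
  interpret \<sigma>: group_hom G G \<sigma> by (rule auto_group_hom[OF assms(1)])
  have "\<sigma> (l \<otimes> g) = \<sigma> l \<otimes> \<sigma> g" if "l \<in> L" for l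
    using that assms by auto
  then show ?thesis by (auto simp: r_coset_def image_iff)
qed

lemma (in group) cayley_iso_restrict:
  assumes f: "cayley_iso G P f" and U: "subgroup U G" and fU: "f ` U = U"
  shows "cayley_iso (G\<lparr>carrier := U\<rparr>) {X \<in> P. X \<subseteq> U} f"
proof -
  interpret U: subgroup U G by (rule U)
  have inv: "inv\<^bsub>G\<lparr>carrier := U\<rparr>\<^esub> x = inv x" if "x \<in> U" for x
    using that U by simp
  have fu: "f x \<in> U" if "x \<in> U" for x using that fU by blast
  have "bij_betw f U U"
    using f fU U.subset unfolding cayley_iso_def bij_betw_def by (blast intro: inj_on_subset)
  moreover have "h \<otimes> inv g \<in> X \<longleftrightarrow> f h \<otimes> inv (f g) \<in> f ` X"
    if "X \<in> P" "g \<in> U" "h \<in> U" for X g h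
    using f that U.subset unfolding cayley_iso_def by blast
  ultimately show ?thesis
    using f fu unfolding cayley_iso_def by (simp add: inv)
qed

lemma image_blocks_subset:
  assumes "inj_on f (\<Union>P)" "f ` U = U" "U \<subseteq> \<Union>P"
  shows "(`) f ` {X \<in> P. X \<subseteq> U} = {Y \<in> (`) f ` P. Y \<subseteq> U}"
proof -
  have "f ` X \<subseteq> U \<longleftrightarrow> X \<subseteq> U" if "X \<in> P" for X
  proof
    assume fX: "f ` X \<subseteq> U"
    show "X \<subseteq> U"
    proof
      fix x assume x: "x \<in> X"
      then have "f x \<in> f ` U" using fX assms(2) by auto
      then show "x \<in> U"
        using inj_on_image_mem_iff[OF assms(1) _ assms(3)] x that by blast
    qed
  qed (use assms(2) in blast)
  then show ?thesis by blast
qed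

lemma (in group) cayley_iso_quotient:
  assumes fin: "finite (carrier G)" and P: "s_partition G P" and f: "cayley_iso G P f"
    and L: "L \<lhd> G" "union_of_blocks P L" and fL: "f ` L = L"
  shows "cayley_iso (G Mod L) ((`) ((#>) L) ` P) ((`) f)"
proof -
  interpret L: normal L G by (rule L)
  let ?M = "G Mod L" and ?\<pi> = "(#>) L"
  interpret M: group ?M by (rule L.factorgroup_is_group)
  interpret \<pi>: group_hom G ?M ?\<pi>
    by unfold_locales (rule L.r_coset_hom_Mod)
  note LS = L.subgroup_axioms
  have carM: "carrier ?M = ?\<pi> ` carrier G" by (rule carrier_FactGroup)
  have b: "bij_betw f (carrier G) (carrier G)"
    using f by (auto simp: cayley_iso_def)
  have fc: "f x \<in> carrier G" if "x \<in> carrier G" for x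
    using b that bij_betwE by blast
  have F: "f ` ?\<pi> g = ?\<pi> (f g)" if "g \<in> carrier G" for g
    using cayley_iso_image_coset[OF f LS L(2) that] fL by simp
  have "(`) f ` ?\<pi> ` carrier G = ?\<pi> ` f ` carrier G"
    unfolding image_image by (intro image_cong refl F)
  then have "(`) f ` carrier ?M = carrier ?M"
    using b carM by (simp add: bij_betw_def)
  moreover have "inj_on ((`) f) (carrier ?M)"
  proof (rule inj_onI)
    fix C D assume "C \<in> carrier ?M" "D \<in> carrier ?M" and eq: "f ` C = f ` D"
    then have "C \<subseteq> carrier G" "D \<subseteq> carrier G"
      unfolding carM using r_coset_subset_G[OF L.subset] by blast+
    then show "C = D" using inj_on_image_eq_iff[of f "carrier G" C D] b eq by (simp add: bij_betw_def)
  qed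
  ultimately have bM: "bij_betw ((`) f) (carrier ?M) (carrier ?M)"
    by (simp add: bij_betw_def)
  have mem: "?\<pi> g \<in> ?\<pi> ` X \<longleftrightarrow> g \<in> L <#> X" if "g \<in> carrier G" "X \<subseteq> carrier G" for g X
  proof
    assume "?\<pi> g \<in> ?\<pi> ` X"
    then obtain x where "x \<in> X" "?\<pi> g = ?\<pi> x" by blast
    then show "g \<in> L <#> X"
      using rcos_self[OF that(1) LS] unfolding set_mult_eq_Union_cosets by blast
  next
    assume "g \<in> L <#> X"
    then obtain x where x: "x \<in> X" "g \<in> ?\<pi> x" unfolding set_mult_eq_Union_cosets by blast
    then have "?\<pi> x = ?\<pi> g" using repr_independence[OF x(2) _ LS] that by blast
    then show "?\<pi> g \<in> ?\<pi> ` X" using x by blast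
  qed
  have "D \<otimes>\<^bsub>?M\<^esub> inv\<^bsub>?M\<^esub> C \<in> B \<longleftrightarrow> f ` D \<otimes>\<^bsub>?M\<^esub> inv\<^bsub>?M\<^esub> (f ` C) \<in> (`) f ` B"
    if B: "B \<in> (`) ?\<pi> ` P" and CD: "C \<in> carrier ?M" "D \<in> carrier ?M" for B C D
  proof -
    obtain X where X: "X \<in> P" "B = ?\<pi> ` X" using B by blast
    obtain g h where g: "g \<in> carrier G" "C = ?\<pi> g" and h: "h \<in> carrier G" "D = ?\<pi> h"
      using CD unfolding carM by blast
    have XG: "X \<subseteq> carrier G" by (rule s_partition_subset[OF P X(1)])
    have quot: "?\<pi> k \<otimes>\<^bsub>?M\<^esub> inv\<^bsub>?M\<^esub> ?\<pi> l = ?\<pi> (k \<otimes> inv l)"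
      if "k \<in> carrier G" "l \<in> carrier G" for k l
      using that \<pi>.hom_inv[OF that(2)] \<pi>.hom_mult[of k "inv l"] by (simp del: mult_FactGroup)
    have FB: "(`) f ` B = ?\<pi> ` f ` X"
      unfolding X(2) image_image using XG by (intro image_cong refl F) blast
    have LX: "union_of_blocks P (L <#> X)"
      using set_mult_union_of_blocks[OF fin P L(2)
          block_union_of_blocks[OF s_partition_partition[OF P] X(1)]] .
    have fLX: "f ` (L <#> X) = L <#> f ` X"
      unfolding set_mult_eq_Union_cosets image_Union FB[symmetric] X(2) ..
    have "D \<otimes>\<^bsub>?M\<^esub> inv\<^bsub>?M\<^esub> C \<in> B \<longleftrightarrow> h \<otimes> inv g \<in> L <#> X"
      unfolding g(2) h(2) quot[OF h(1) g(1)] X(2) using g h XG by (intro mem) auto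
    also have "\<dots> \<longleftrightarrow> f h \<otimes> inv (f g) \<in> f ` (L <#> X)"
      by (rule cayley_iso_union_of_blocks[OF f LX g(1) h(1)])
    also have "\<dots> \<longleftrightarrow> ?\<pi> (f h \<otimes> inv (f g)) \<in> ?\<pi> ` f ` X"
      unfolding fLX using g h fc XG by (intro mem[symmetric]) auto
    also have "?\<pi> (f h \<otimes> inv (f g)) = f ` D \<otimes>\<^bsub>?M\<^esub> inv\<^bsub>?M\<^esub> (f ` C)"
      unfolding g(2) h(2) F[OF g(1)] F[OF h(1)] by (rule quot[OF fc[OF h(1)] fc[OF g(1)], symmetric])
    finally show ?thesis unfolding FB .
  qed
  then show ?thesis
    unfolding cayley_iso_def using bM fL by simp
qed

section \<open>Gluing automorphisms of \<open>U\<close> and of \<open>G/L\<close>\<close>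

context squarefree_exponent_group
begin

text \<open>With \<open>V\<close> a complement of \<open>U\<close> and \<open>K\<close> a complement
  of \<open>L\<close>, send \<open>u \<otimes> v\<close> to
  \<open>\<sigma>1 u \<otimes> \<psi> v\<close>, where \<open>\<psi> v\<close> is the representative
  in \<open>K\<close> of \<open>\<sigma>2 (L #> v)\<close>. The hypothesis \<open>agree\<close>
  gives the right value modulo \<open>L\<close> on the factor \<open>U\<close>.\<close>

lemma auto_lift:
  assumes L: "subgroup L G" and U: "subgroup U G" and LU: "L \<subseteq> U"
    and \<sigma>1: "\<sigma>1 \<in> auto (G\<lparr>carrier := U\<rparr>)" and \<sigma>2: "\<sigma>2 \<in> auto (G Mod L)"
    and agree: "\<And>u. u \<in> U \<Longrightarrow> \<sigma>2 (L #> u) = L #> \<sigma>1 u"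
  obtains \<sigma> where "\<sigma> \<in> auto G" "\<And>u. u \<in> U \<Longrightarrow> \<sigma> u = \<sigma>1 u"
    "\<And>g. g \<in> carrier G \<Longrightarrow> L #> \<sigma> g = \<sigma>2 (L #> g)"
proof -
  interpret L: normal L G by (rule subgroup_imp_normal[OF L])
  interpret U: subgroup U G by (rule U)
  let ?M = "G Mod L" and ?\<pi> = "(#>) L" and ?U = "G\<lparr>carrier := U\<rparr>"
  interpret M: group ?M by (rule L.factorgroup_is_group)
  interpret \<pi>: group_hom G ?M ?\<pi>
    by unfold_locales (rule L.r_coset_hom_Mod)
  interpret GU: group ?U by (rule subgroup_imp_group[OF U])
  interpret \<sigma>1: group_hom ?U ?U \<sigma>1 by (rule GU.auto_group_hom[OF \<sigma>1])
  interpret \<sigma>2: group_hom ?M ?M \<sigma>2 by (rule M.auto_group_hom[OF \<sigma>2])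
  obtain V where V: "subgroup V G" "U \<inter> V = {\<one>}" "U <#> V = carrier G"
    using exists_complement[OF U] .
  obtain K where K: "subgroup K G" "L \<inter> K = {\<one>}" "L <#> K = carrier G"
    using exists_complement[OF L] .
  interpret V: subgroup V G by (rule V)
  interpret K: subgroup K G by (rule K)
  have carM: "carrier ?M = ?\<pi> ` carrier G" by (rule carrier_FactGroup)
  have rep: "\<exists>k\<in>K. ?\<pi> k = C" if C: "C \<in> carrier ?M" for C
  proof -
    obtain g where g: "g \<in> carrier G" "C = ?\<pi> g" using C unfolding carM by blast
    then have "g \<in> L <#> K" using K by simp
    then obtain k where k: "k \<in> K" "g \<in> ?\<pi> k" unfolding set_mult_eq_Union_cosets by blast
    have "?\<pi> k = ?\<pi> g" using repr_independence[OF k(2) _ L] k K.subset by blast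
    then show ?thesis using k g by blast
  qed
  have uniq: "k = k'" if "k \<in> K" "k' \<in> K" "?\<pi> k = ?\<pi> k'" for k k'
  proof -
    have kc: "k \<in> carrier G" using that K.subset by blast
    have "k \<in> ?\<pi> k'" using rcos_self[OF kc L] that by simp
    then obtain l where "l \<in> L" "k = l \<otimes> k'" by (auto simp: r_coset_def)
    then have "\<one> \<otimes> k = l \<otimes> k'" using kc by simp
    then show ?thesis
      using complement_decomposition_unique[OF L K(1,2) L.one_closed \<open>l \<in> L\<close> that(1,2)] by blast
  qed
  \<comment> \<open>\<open>K\<close> contains exactly one element of each coset of \<open>L\<close>
    and is closed under products, so this choice of representatives is multiplicative.\<close>
  define \<psi> where "\<psi> v = (SOME k. k \<in> K \<and> ?\<pi> k = \<sigma>2 (?\<pi> v))" for v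
  have \<psi>: "\<psi> v \<in> K \<and> ?\<pi> (\<psi> v) = \<sigma>2 (?\<pi> v)" if "v \<in> carrier G" for v
  proof -
    have "?\<pi> v \<in> carrier ?M" using that carM by blast
    then have "\<sigma>2 (?\<pi> v) \<in> carrier ?M" by (rule \<sigma>2.hom_closed)
    from rep[OF this] have "\<exists>k. k \<in> K \<and> ?\<pi> k = \<sigma>2 (?\<pi> v)" by blast
    then show ?thesis unfolding \<psi>_def by (rule someI_ex)
  qed
  have \<pi>c: "?\<pi> g \<in> carrier ?M" if "g \<in> carrier G" for g using that carM by blast
  have \<psi>c: "\<psi> v \<in> carrier G" if "v \<in> carrier G" for v using \<psi>[OF that] K.subset by blast
  have \<psi>m: "\<psi> (v \<otimes> w) = \<psi> v \<otimes> \<psi> w" if vw: "v \<in> carrier G" "w \<in> carrier G" for v w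
  proof (rule uniq)
    show "\<psi> (v \<otimes> w) \<in> K" "\<psi> v \<otimes> \<psi> w \<in> K" using \<psi> vw by auto
    have "?\<pi> (\<psi> (v \<otimes> w)) = \<sigma>2 (?\<pi> (v \<otimes> w))" using \<psi> vw by blast
    also have "\<dots> = \<sigma>2 (?\<pi> v) \<otimes>\<^bsub>?M\<^esub> \<sigma>2 (?\<pi> w)"
      unfolding \<pi>.hom_mult[OF vw] using \<pi>c vw by (intro \<sigma>2.hom_mult)
    also have "\<dots> = ?\<pi> (\<psi> v) \<otimes>\<^bsub>?M\<^esub> ?\<pi> (\<psi> w)" using \<psi> vw by metis
    also have "\<dots> = ?\<pi> (\<psi> v \<otimes> \<psi> w)"
      using \<psi>c vw by (intro \<pi>.hom_mult[symmetric])
    finally show "?\<pi> (\<psi> (v \<otimes> w)) = ?\<pi> (\<psi> v \<otimes> \<psi> w)" .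
  qed
  have \<psi>V: "\<psi> \<in> hom (G\<lparr>carrier := V\<rparr>) G"
    using \<psi>c \<psi>m V.subset by (intro homI) (auto simp: subset_iff)
  have \<sigma>1U: "\<sigma>1 \<in> hom ?U G"
    using \<sigma>1.hom_closed \<sigma>1.hom_mult U.subset by (intro homI) (auto simp: subset_iff)
  obtain \<theta> where \<theta>: "\<theta> \<in> hom (G\<lparr>carrier := U <#> V\<rparr>) G"
    and \<theta>_eq: "\<And>u v. u \<in> U \<Longrightarrow> v \<in> V \<Longrightarrow> \<theta> (u \<otimes> v) = \<sigma>1 u \<otimes> \<psi> v"
    using hom_glue_complements[OF U V(1,2) comm_group_axioms \<sigma>1U \<psi>V] by blast
  have \<theta>hom: "\<theta> \<in> hom G G" using \<theta> V(3) by simp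
  interpret \<theta>: group_hom G G \<theta> by unfold_locales (rule \<theta>hom)
  have \<sigma>1c: "\<sigma>1 u \<in> carrier G" if "u \<in> U" for u
    using \<sigma>1.hom_closed[of u] that U.subset by auto
  have "\<psi> \<one> = \<psi> \<one> \<otimes> \<psi> \<one>" using \<psi>m[of \<one> \<one>] by simp
  then have \<psi>1: "\<psi> \<one> = \<one>" using \<psi>c[of \<one>] by (metis l_cancel_one' one_closed)
  have \<theta>U: "\<theta> u = \<sigma>1 u" if "u \<in> U" for u
    using \<theta>_eq[OF that V.one_closed] that U.subset \<sigma>1c \<psi>1 by (simp add: subset_iff)
  have \<theta>\<pi>: "?\<pi> (\<theta> g) = \<sigma>2 (?\<pi> g)" if "g \<in> carrier G" for g
  proof -
    obtain u v where uv: "u \<in> U" "v \<in> V" "g = u \<otimes> v"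
      using \<open>g \<in> carrier G\<close> unfolding V(3)[symmetric] set_mult_def by blast
    have c: "u \<in> carrier G" "v \<in> carrier G" using uv U.subset V.subset by blast+
    have "?\<pi> (\<theta> g) = ?\<pi> (\<sigma>1 u) \<otimes>\<^bsub>?M\<^esub> ?\<pi> (\<psi> v)"
      unfolding uv(3) \<theta>_eq[OF uv(1,2)] using \<sigma>1c uv \<psi>c c by (intro \<pi>.hom_mult)
    also have "\<dots> = \<sigma>2 (?\<pi> u) \<otimes>\<^bsub>?M\<^esub> \<sigma>2 (?\<pi> v)"
      using agree[OF uv(1)] \<psi>[OF c(2)] by metis
    also have "\<dots> = \<sigma>2 (?\<pi> g)"
      unfolding uv(3) \<pi>.hom_mult[OF c] using \<pi>c c by (intro \<sigma>2.hom_mult[symmetric])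
    finally show ?thesis .
  qed
  \<comment> \<open>Injectivity of \<open>\<sigma>2\<close> puts the kernel into \<open>L\<close>,
    hence into \<open>U\<close>, where \<open>\<theta>\<close> is the injective map
    \<open>\<sigma>1\<close>.\<close>
  have "x = \<one>" if x: "x \<in> carrier G" "\<theta> x = \<one>" for x
  proof -
    have "\<sigma>2 (?\<pi> x) = \<sigma>2 (?\<pi> \<one>)" using \<theta>\<pi>[OF x(1)] \<theta>\<pi>[OF one_closed] x by simp
    then have "?\<pi> x = ?\<pi> \<one>"
      using auto_bij_betw[OF \<sigma>2] \<pi>c[OF x(1)] \<pi>c[OF one_closed]
      unfolding bij_betw_def inj_on_def by blast
    then have "x \<in> L" using rcos_self[OF x(1) L] L.subset by simp
    then have xU: "x \<in> U" using LU by blast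
    then have "\<sigma>1 x = \<sigma>1 \<one>" using \<theta>U x \<theta>U[OF U.one_closed] by simp
    then show ?thesis
      using auto_bij_betw[OF \<sigma>1] xU U.one_closed by (auto simp: bij_betw_def inj_on_def)
  qed
  then have inj: "inj_on \<theta> (carrier G)" using \<theta>.inj_on_one_iff by blast
  moreover have "\<theta> ` carrier G = carrier G"
    using inj finite_carrier by (intro endo_inj_surj) auto
  ultimately have "restrict \<theta> (carrier G) \<in> auto G"
    using \<theta>hom by (simp add: auto_def Bij_def bij_betw_def hom_def inj_on_restrict_eq Pi_iff)
  moreover have "restrict \<theta> (carrier G) u = \<sigma>1 u" if "u \<in> U" for u
    using that \<theta>U U.subset by auto
  moreover have "?\<pi> (restrict \<theta> (carrier G) g) = \<sigma>2 (?\<pi> g)" if "g \<in> carrier G" for g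
    using that \<theta>\<pi> by simp
  ultimately show thesis using that by blast
qed

text \<open>The core argument, for an \<open>f\<close> that already preserves the flag. The
  hypothesis \<open>factor\<close> is the factorization of the automorphisms of the section read off
  on cosets, with \<open>\<tau>1\<close> acting first.\<close>

lemma wreath_iso_block_auto:
  assumes P: "s_partition G P" and L: "subgroup L G" and U: "subgroup U G" and LU: "L \<subseteq> U"
    and LP: "union_of_blocks P L" and UP: "union_of_blocks P U"
    and wreath: "\<And>X. X \<in> P \<Longrightarrow> \<not> X \<subseteq> U \<Longrightarrow> L <#> X = X"
    and f: "cayley_iso G P f" and P': "s_partition G ((`) f ` P)"
    and fU: "f ` U = U" and fL: "f ` L = L"
    and ciU: "ci_sring (G\<lparr>carrier := U\<rparr>) (int_span {X \<in> P. X \<subseteq> U})"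
    and ciQ: "ci_sring (G Mod L) (int_span ((`) ((#>) L) ` P))"
    and factor: "\<And>\<rho>. \<rho> \<in> auto (G\<lparr>carrier := U\<rparr> Mod L) \<Longrightarrow>
      (\<And>X. X \<in> P \<Longrightarrow> X \<subseteq> U \<Longrightarrow> \<rho> ` (#>) L ` X = (#>) L ` X) \<Longrightarrow>
      \<exists>\<tau>1 \<tau>2. \<tau>1 \<in> auto (G\<lparr>carrier := U\<rparr>) \<and> (\<forall>X\<in>P. X \<subseteq> U \<longrightarrow> \<tau>1 ` X = X) \<and>
        \<tau>2 \<in> auto (G Mod L) \<and> (\<forall>X\<in>P. \<tau>2 ` (#>) L ` X = (#>) L ` X) \<and>
        (\<forall>u\<in>U. \<rho> (L #> u) = \<tau>2 (\<tau>1 ` (L #> u)))"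
  shows "\<exists>\<sigma>\<in>auto G. \<forall>X\<in>P. f ` X = \<sigma> ` X"
proof -
  have Ln: "L \<lhd> G" by (rule subgroup_imp_normal[OF L])
  interpret L: normal L G by (rule Ln)
  interpret U: subgroup U G by (rule U)
  let ?M = "G Mod L" and ?\<pi> = "(#>) L" and ?U = "G\<lparr>carrier := U\<rparr>"
  interpret M: group ?M by (rule L.factorgroup_is_group)
  interpret \<pi>: group_hom G ?M ?\<pi>
    by unfold_locales (rule L.r_coset_hom_Mod)
  interpret GU: group ?U by (rule subgroup_imp_group[OF U])
  note fin = finite_carrier
  have finU: "finite (carrier ?U)" using subgroup_finite[OF U] by simp
  have carM: "carrier ?M = ?\<pi> ` carrier G" by (rule carrier_FactGroup)
  have finM: "finite (carrier ?M)" using fin carM by simp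
  have fb: "bij_betw f (carrier G) (carrier G)" using f by (simp add: cayley_iso_def)
  have fc: "f x \<in> carrier G" if "x \<in> carrier G" for x
    using fb that bij_betwE by blast
  have \<pi>c: "?\<pi> g \<in> carrier ?M" if "g \<in> carrier G" for g using that carM by blast
  have PG: "X \<subseteq> carrier G" if "X \<in> P" for X by (rule s_partition_subset[OF P that])
  have PU: "\<Union>P = carrier G" by (rule s_partition_Union[OF P])
  have inj: "inj_on f (\<Union>P)" using fb PU by (simp add: bij_betw_def)
  have F: "f ` ?\<pi> g = ?\<pi> (f g)" if "g \<in> carrier G" for g
    using cayley_iso_image_coset[OF f L LP that] fL by simp
  have LP': "union_of_blocks ((`) f ` P) L" and UP': "union_of_blocks ((`) f ` P) U"
    using union_of_blocks_image[OF inj LP] union_of_blocks_image[OF inj UP] fL fU by simp_all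

  have partU: "s_partition ?U {X \<in> P. X \<subseteq> U}" by (rule s_partition_subgroup[OF fin P U UP])
  have "s_partition ?U ((`) f ` {X \<in> P. X \<subseteq> U})"
    unfolding image_blocks_subset[OF inj fU U.subset[folded PU]]
    by (rule s_partition_subgroup[OF fin P' U UP'])
  with mp[OF spec[OF iffD1[OF GU.ci_sring_iff[OF finU partU] ciU]] conjI[OF cayley_iso_restrict[OF f U fU]]]
  obtain \<sigma>1 where \<sigma>1: "\<sigma>1 \<in> auto ?U" and \<sigma>1X: "\<forall>X\<in>{X \<in> P. X \<subseteq> U}. f ` X = \<sigma>1 ` X"
    by (elim meta_impE bexE) auto

  have partM: "s_partition ?M ((`) ?\<pi> ` P)" by (rule s_partition_quotient[OF fin P Ln LP])
  have F\<pi>: "(`) f ` ?\<pi> ` X = ?\<pi> ` f ` X" if "X \<subseteq> carrier G" for X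
    unfolding image_image using that by (intro image_cong refl F) blast
  have "(`) ((`) f) ` (`) ?\<pi> ` P = (`) ?\<pi> ` (`) f ` P"
    unfolding image_image[of "(`) ((`) f)"] image_image[of "(`) ?\<pi>"] using PG by (intro image_cong refl F\<pi>)
  then have "s_partition ?M ((`) ((`) f) ` (`) ?\<pi> ` P)"
    using s_partition_quotient[OF fin P' Ln LP'] by simp
  with mp[OF spec[OF iffD1[OF M.ci_sring_iff[OF finM partM] ciQ]]
      conjI[OF cayley_iso_quotient[OF fin P f Ln LP fL]]]
  obtain \<sigma>2 where \<sigma>2: "\<sigma>2 \<in> auto ?M" and \<sigma>2X: "\<forall>B\<in>(`) ?\<pi> ` P. (`) f ` B = \<sigma>2 ` B"
    by (elim meta_impE bexE) auto

  interpret \<sigma>1: group_hom ?U ?U \<sigma>1 by (rule GU.auto_group_hom[OF \<sigma>1])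
  interpret \<sigma>2: group_hom ?M ?M \<sigma>2 by (rule M.auto_group_hom[OF \<sigma>2])
  have \<sigma>1b: "bij_betw \<sigma>1 U U" using auto_bij_betw[OF \<sigma>1] by simp
  have \<sigma>1u: "\<sigma>1 u \<in> U" if "u \<in> U" for u using \<sigma>1b that bij_betwE by blast
  have \<sigma>1L: "\<sigma>1 ` L = L"
    using image_eq_if_blocks_image_eq[OF LP, of f \<sigma>1] \<sigma>1X LU fL by auto
  have \<sigma>1\<pi>: "\<sigma>1 ` ?\<pi> u = ?\<pi> (\<sigma>1 u)" if "u \<in> U" for u
    using GU.auto_image_coset[OF \<sigma>1, of L u] \<sigma>1L LU that by simp
  have \<sigma>2\<pi>: "\<sigma>2 ` ?\<pi> ` X = ?\<pi> ` f ` X" if "X \<in> P" for X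
    unfolding bspec[OF \<sigma>2X imageI[OF that], symmetric] by (rule F\<pi>[OF PG[OF that]])
  \<comment> \<open>\<open>\<sigma>2\<close> comes from the quotient and carries no information
    about \<open>U\<close> by itself. It stabilizes \<open>U/L\<close> because \<open>U\<close> is a
    union of blocks, on whose images \<open>\<sigma>2\<close> acts like \<open>f\<close>.\<close>
  have \<sigma>2U: "\<sigma>2 ` ?\<pi> ` U = ?\<pi> ` U"
  proof -
    have "(\<lambda>x. \<sigma>2 (?\<pi> x)) ` U = (\<lambda>x. ?\<pi> (f x)) ` U"
      by (rule image_eq_if_blocks_image_eq[OF UP]) (use \<sigma>2\<pi> in \<open>simp add: image_image\<close>)
    then have "\<sigma>2 ` ?\<pi> ` U = ?\<pi> ` f ` U" by (simp add: image_image)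
    then show ?thesis using fU by simp
  qed
  obtain \<sigma>2' where \<sigma>2': "\<sigma>2' \<in> auto ?M" "\<And>C. C \<in> carrier ?M \<Longrightarrow> \<sigma>2' (\<sigma>2 C) = C"
    "\<And>C. C \<in> carrier ?M \<Longrightarrow> \<sigma>2 (\<sigma>2' C) = C"
    using M.auto_inverse[OF \<sigma>2] by blast
  interpret \<sigma>2': group_hom ?M ?M \<sigma>2' by (rule M.auto_group_hom[OF \<sigma>2'(1)])
  have \<sigma>2'_image: "\<sigma>2' ` \<sigma>2 ` B = B" if "B \<subseteq> carrier ?M" for B
  proof -
    have "(\<lambda>C. \<sigma>2' (\<sigma>2 C)) ` B = (\<lambda>C. C) ` B"
      using that by (intro image_cong refl \<sigma>2'(2)) blast
    then show ?thesis by (simp add: image_image)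
  qed
  have \<pi>UM: "?\<pi> ` U \<subseteq> carrier ?M" using \<pi>c U.subset by blast

  let ?S = "?U Mod L"
  have carS: "carrier ?S = ?\<pi> ` U" by (simp add: carrier_FactGroup)
  \<comment> \<open>The discrepancy of \<open>\<sigma>1\<close> and \<open>\<sigma>2\<close> on
    \<open>U/L\<close>; it is the identity exactly when they agree there.\<close>
  define \<rho> where "\<rho> = (\<lambda>C\<in>carrier ?S. \<sigma>2' (\<sigma>1 ` C))"
  have \<rho>\<pi>: "\<rho> (?\<pi> u) = \<sigma>2' (?\<pi> (\<sigma>1 u))" if "u \<in> U" for u
    using that \<sigma>1\<pi>[OF that] carS by (simp add: \<rho>_def)
  have \<rho>im: "\<rho> ` ?\<pi> ` X = \<sigma>2' ` ?\<pi> ` \<sigma>1 ` X" if "X \<subseteq> U" for X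
    unfolding image_image using that by (intro image_cong refl \<rho>\<pi>) blast
  have \<rho>S: "\<rho> ` carrier ?S = carrier ?S"
    unfolding carS \<rho>im[OF subset_refl]
    using \<sigma>1b \<sigma>2'_image[OF \<pi>UM] unfolding \<sigma>2U bij_betw_def by simp
  have "\<rho> \<in> auto ?S"
  proof -
    have finS: "finite (carrier ?S)" using finU carS by simp
    have "inj_on \<rho> (carrier ?S)"
      using \<rho>S finS by (intro eq_card_imp_inj_on) auto
    then have "\<rho> \<in> Bij (carrier ?S)"
      using \<rho>S by (simp add: Bij_def bij_betw_def \<rho>_def)
    moreover have "\<rho> \<in> hom ?S ?S"
    proof (rule homI)
      fix C assume "C \<in> carrier ?S"
      then show "\<rho> C \<in> carrier ?S" using \<rho>S by blast
    next
      fix C D assume "C \<in> carrier ?S" "D \<in> carrier ?S"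
      then obtain u v where uv: "u \<in> U" "C = ?\<pi> u" "v \<in> U" "D = ?\<pi> v"
        unfolding carS by blast
      have c: "u \<in> carrier G" "v \<in> carrier G" "\<sigma>1 u \<in> carrier G" "\<sigma>1 v \<in> carrier G"
        using uv U.subset \<sigma>1u by blast+
      have \<sigma>1m: "\<sigma>1 (u \<otimes> v) = \<sigma>1 u \<otimes> \<sigma>1 v" using \<sigma>1.hom_mult[of u v] uv by simp
      have "\<rho> (C <#> D) = \<rho> (?\<pi> (u \<otimes> v))"
        using L.rcos_sum[OF c(1,2)] uv by simp
      also have "\<dots> = \<sigma>2' (?\<pi> (\<sigma>1 u) \<otimes>\<^bsub>?M\<^esub> ?\<pi> (\<sigma>1 v))"
        using \<rho>\<pi>[of "u \<otimes> v"] uv \<sigma>1m \<pi>.hom_mult[OF c(3,4)] by (simp del: mult_FactGroup)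
      also have "\<dots> = \<rho> C \<otimes>\<^bsub>?M\<^esub> \<rho> D"
        using \<sigma>2'.hom_mult[OF \<pi>c[OF c(3)] \<pi>c[OF c(4)]] \<rho>\<pi>[OF uv(1)] \<rho>\<pi>[OF uv(3)] uv
        by (simp del: mult_FactGroup)
      finally show "\<rho> (C \<otimes>\<^bsub>?S\<^esub> D) = \<rho> C \<otimes>\<^bsub>?S\<^esub> \<rho> D" by simp
    qed
    ultimately show ?thesis by (simp add: auto_def)
  qed
  \<comment> \<open>\<open>\<sigma>1\<close> moves \<open>X\<close> as \<open>f\<close> does and the
    inverse of \<open>\<sigma>2\<close> moves its image back, so \<open>\<rho>\<close> fixes the
    basic sets of the section.\<close>
  moreover have "\<rho> ` ?\<pi> ` X = ?\<pi> ` X" if X: "X \<in> P" "X \<subseteq> U" for X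
  proof -
    have "\<rho> ` ?\<pi> ` X = \<sigma>2' ` ?\<pi> ` f ` X" using \<rho>im[OF X(2)] \<sigma>1X X by simp
    also have "\<dots> = ?\<pi> ` X"
      unfolding \<sigma>2\<pi>[OF X(1), symmetric] by (rule \<sigma>2'_image) (use \<pi>c PG[OF X(1)] in blast)
    finally show ?thesis .
  qed
  ultimately obtain \<tau>1 \<tau>2 where \<tau>1: "\<tau>1 \<in> auto ?U" and \<tau>1X: "\<forall>X\<in>P. X \<subseteq> U \<longrightarrow> \<tau>1 ` X = X"
    and \<tau>2: "\<tau>2 \<in> auto ?M" and \<tau>2X: "\<forall>X\<in>P. \<tau>2 ` ?\<pi> ` X = ?\<pi> ` X"
    and \<tau>: "\<forall>u\<in>U. \<rho> (?\<pi> u) = \<tau>2 (\<tau>1 ` ?\<pi> u)"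
    using factor[of \<rho>] by (elim meta_impE exE conjE) auto
  obtain \<tau>1' where \<tau>1': "\<tau>1' \<in> auto ?U" "\<And>u. u \<in> carrier ?U \<Longrightarrow> \<tau>1' (\<tau>1 u) = u"
    "\<And>u. u \<in> carrier ?U \<Longrightarrow> \<tau>1 (\<tau>1' u) = u"
    using GU.auto_inverse[OF \<tau>1] by blast
  have \<tau>1'u: "\<tau>1' u \<in> U" if "u \<in> U" for u
    using auto_bij_betw[OF \<tau>1'(1)] that by (auto simp: bij_betw_def)
  have \<tau>2c: "\<tau>2 C \<in> carrier ?M" if "C \<in> carrier ?M" for C
    using auto_bij_betw[OF \<tau>2] that by (auto simp: bij_betw_def)
  have \<tau>1L: "\<tau>1 ` L = L"
    using image_eq_if_blocks_image_eq[OF LP, of \<tau>1 id] \<tau>1X LU by auto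
  \<comment> \<open>From \<open>\<sigma>2^-1 \<sigma>1 = \<tau>2 \<tau>1\<close> on
    \<open>U/L\<close> follows \<open>\<sigma>1 \<tau>1^-1 = \<sigma>2 \<tau>2\<close>; hence an
    inverse on the side of \<open>U\<close> only.\<close>
  let ?s1 = "compose (carrier ?U) \<sigma>1 \<tau>1'" and ?s2 = "compose (carrier ?M) \<sigma>2 \<tau>2"
  have s1: "?s1 \<in> auto ?U" by (rule GU.auto_compose[OF \<sigma>1 \<tau>1'(1)])
  have s2: "?s2 \<in> auto ?M" by (rule M.auto_compose[OF \<sigma>2 \<tau>2])
  have s1X: "?s1 ` X = f ` X" if X: "X \<in> P" "X \<subseteq> U" for X
  proof -
    have "\<tau>1' ` \<tau>1 ` X = X"
    proof -
      have "(\<lambda>x. \<tau>1' (\<tau>1 x)) ` X = (\<lambda>x. x) ` X"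
        using X(2) by (intro image_cong refl \<tau>1'(2)) auto
      then show ?thesis by (simp add: image_image)
    qed
    then have "\<tau>1' ` X = X" using \<tau>1X X by simp
    moreover have "?s1 ` X = \<sigma>1 ` \<tau>1' ` X"
      unfolding image_image using X(2) by (intro image_cong refl) (auto simp: compose_def)
    ultimately show ?thesis using \<sigma>1X X by simp
  qed
  have agree: "?s2 (?\<pi> u) = ?\<pi> (?s1 u)" if u: "u \<in> U" for u
  proof -
    \<comment> \<open>Writing \<open>u\<close> as \<open>\<tau>1 ?w\<close> reduces the agreement at
      \<open>u\<close> to the factorization of \<open>\<rho>\<close> at the coset of
      \<open>?w\<close>.\<close>
    let ?w = "\<tau>1' u"
    have w: "?w \<in> U" "\<tau>1 ?w = u" using \<tau>1'u u \<tau>1'(3) by auto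
    have uc: "u \<in> carrier G" using u U.subset by blast
    have "\<tau>1 ` ?\<pi> ?w = ?\<pi> u"
      using GU.auto_image_coset[OF \<tau>1, of L ?w] \<tau>1L LU w by simp
    then have "\<tau>2 (?\<pi> u) = \<sigma>2' (?\<pi> (\<sigma>1 ?w))" using bspec[OF \<tau> w(1)] \<rho>\<pi>[OF w(1)] by simp
    then have "\<sigma>2 (\<tau>2 (?\<pi> u)) = ?\<pi> (\<sigma>1 ?w)"
      using \<sigma>2'(3)[OF \<pi>c, of "\<sigma>1 ?w"] \<sigma>1u[OF w(1)] U.subset by auto
    then show ?thesis using u \<pi>c[OF uc] by (simp add: compose_eq)
  qed
  obtain \<sigma> where \<sigma>: "\<sigma> \<in> auto G" and \<sigma>U: "\<And>u. u \<in> U \<Longrightarrow> \<sigma> u = ?s1 u"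
    and \<sigma>M: "\<And>g. g \<in> carrier G \<Longrightarrow> ?\<pi> (\<sigma> g) = ?s2 (?\<pi> g)"
    using auto_lift[OF L U LU s1 s2 agree] by blast
  interpret \<sigma>: group_hom G G \<sigma> by (rule auto_group_hom[OF \<sigma>])
  have \<sigma>X: "\<sigma> ` X = f ` X" if X: "X \<in> P" "X \<subseteq> U" for X
    unfolding s1X[OF X, symmetric] using X(2) by (intro image_cong refl \<sigma>U) blast
  have \<sigma>L: "\<sigma> ` L = L"
    using image_eq_if_blocks_image_eq[OF LP, of \<sigma> f] \<sigma>X LU fL by auto
  have "f ` X = \<sigma> ` X" if X: "X \<in> P" for X
  proof (cases "X \<subseteq> U")
    case True
    then show ?thesis using \<sigma>X[OF X] by simp
  next
    case False
    note XG = PG[OF X]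
    \<comment> \<open>Outside \<open>U\<close> the maps are compared only modulo \<open>L\<close>.
      Since \<open>X\<close> and its images under \<open>f\<close> and \<open>\<sigma>\<close> are
      unions of cosets of \<open>L\<close>, they are recovered from their images in the
      quotient.\<close>
    have "?\<pi> ` \<sigma> ` X = \<sigma>2 ` \<tau>2 ` ?\<pi> ` X"
      unfolding image_image using XG by (intro image_cong refl) (auto simp: \<sigma>M compose_eq \<pi>c)
    also have "\<dots> = ?\<pi> ` f ` X" using bspec[OF \<tau>2X X] \<sigma>2\<pi>[OF X] by simp
    finally have eq: "?\<pi> ` \<sigma> ` X = ?\<pi> ` f ` X" .
    have "f ` X = f ` (L <#> X)" using wreath[OF X False] by simp
    also have "\<dots> = \<Union>(?\<pi> ` f ` X)"
      unfolding set_mult_eq_Union_cosets image_Union F\<pi>[OF XG] ..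
    also have "\<dots> = \<Union>((`) \<sigma> ` ?\<pi> ` X)"
    proof -
      have "(`) \<sigma> ` ?\<pi> ` X = ?\<pi> ` \<sigma> ` X"
        unfolding image_image using XG auto_image_coset[OF \<sigma> L.subset] \<sigma>L
        by (intro image_cong refl) auto
      then show ?thesis using eq by simp
    qed
    also have "\<dots> = \<sigma> ` (L <#> X)"
      unfolding set_mult_eq_Union_cosets image_Union ..
    finally show ?thesis using wreath[OF X False] by simp
  qed
  then show ?thesis using \<sigma> by blast
qed

end

text \<open>All three implications pass through one condition: each element of \<open>AutS\<close>
  acts on cosets as some \<open>\<tau>1\<close> followed by some \<open>\<tau>2\<close>, both fixing
  the relevant basic sets. When \<open>AutS\<close> equals one of the two groups, the map from the
  other side is the identity.\<close>

theorem theorem1: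
  fixes G :: "('a, 'm) monoid_scheme" (structure)
    and I :: "'i set" and E :: "'i \<Rightarrow> ('b, 'n) monoid_scheme"
    and A :: "('a \<Rightarrow> int) set" and U L :: "'a set"
  assumes "group G" and "finite (carrier G)"
    and "finite I" and "\<And>i. i \<in> I \<Longrightarrow> elementary_abelian (E i)"
    and "G \<cong> product_group I E"
    and "s_ring G A"
    and "a_section G A U L"
    and "nontrivial_wreath_product G A U L"
    and "ci_sring (G\<lparr>carrier := U\<rparr>) (sub_sring G A U)"
    and "ci_sring (G Mod L) (quotient_sring G A (carrier G) L)"
  defines "S \<equiv> section_group G U L"
  defines "AutS \<equiv> Aut_grp_sring S (quotient_sring G A U L)"
    and "AutU \<equiv> section_perms (G\<lparr>carrier := U\<rparr>) U L
                  (Aut_grp_sring (G\<lparr>carrier := U\<rparr>) (sub_sring G A U))"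
    and "AutGL \<equiv> subgroup_perms (carrier S)
                  (Aut_grp_sring (G Mod L) (quotient_sring G A (carrier G) L))"
  shows "(AutS = perm_prod (carrier S) AutU AutGL \<longrightarrow> ci_sring G A) \<and>
         (AutS = AutU \<longrightarrow> ci_sring G A) \<and>
         (AutS = AutGL \<longrightarrow> ci_sring G A)"
proof -
  obtain Q where Q: "squarefree_exponent_group G Q"
    using squarefree_exponent_group_product[OF assms(1-5)] .
  interpret squarefree_exponent_group G Q by (rule Q)
  note fin = finite_carrier
  obtain P where P: "s_partition G P" and A: "A = int_span P"
    using assms(6) s_ring_iff_s_partition[OF fin] by blast
  have basic: "basic_sets G A = P" unfolding A by (rule basic_sets_s_partition[OF fin P])
  note part = s_partition_partition[OF P]
  have U: "subgroup U G" and L: "subgroup L G"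
    and UP: "union_of_blocks P U" and LP: "union_of_blocks P L"
    using assms(7) unfolding a_section_def a_subgroup_def A underl_in_int_span_iff[OF fin part] by auto
  interpret U: subgroup U G by (rule U)
  interpret L: subgroup L G by (rule L)
  have LU: "L \<subseteq> U"
    using assms(7) normal_imp_subgroup[THEN subgroup.subset] unfolding a_section_def by fastforce
  have Ln: "L \<lhd> G" by (rule subgroup_imp_normal[OF L])
  let ?U = "G\<lparr>carrier := U\<rparr>" and ?M = "G Mod L" and ?\<pi> = "(#>) L"
  let ?PU = "{X \<in> P. X \<subseteq> U}"
  interpret GU: group ?U by (rule subgroup_imp_group[OF U])
  interpret M: group ?M by (rule normal.factorgroup_is_group[OF Ln])
  have LnU: "L \<lhd> ?U" using assms(7) by (simp add: a_section_def)
  interpret S: group "?U Mod L" by (rule normal.factorgroup_is_group[OF LnU])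
  have finU: "finite (carrier ?U)" using subgroup_finite[OF U] by simp
  have finM: "finite (carrier ?M)" using fin by (simp add: carrier_FactGroup)
  have finS: "finite (carrier (?U Mod L))" using finU by (simp add: carrier_FactGroup)
  have PG: "X \<subseteq> carrier G" if "X \<in> P" for X by (rule s_partition_subset[OF P that])
  have partU: "s_partition ?U ?PU" by (rule s_partition_subgroup[OF fin P U UP])
  have partM: "s_partition ?M ((`) ?\<pi> ` P)" by (rule s_partition_quotient[OF fin P Ln LP])
  have "union_of_blocks ?PU L"
    unfolding union_of_blocks_def
  proof
    show "L \<subseteq> \<Union>?PU" using LU Union_blocks_eq[OF UP] by simp
    show "\<forall>X\<in>?PU. X \<subseteq> L \<or> X \<inter> L = {}" using LP by (simp add: union_of_blocks_def)
  qed
  \<comment> \<open>Restricting the carrier leaves multiplication unchanged, so cosets formed in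
    \<open>?U\<close> and in \<open>G\<close> are the same sets.\<close>
  then have partS: "s_partition (?U Mod L) ((`) ?\<pi> ` ?PU)"
    using GU.s_partition_quotient[OF finU partU LnU] by (simp add: r_coset_def)
  have subU: "sub_sring G A U = int_span ?PU" by (simp add: sub_sring_def basic)
  have quotM: "quotient_sring G A (carrier G) L = int_span ((`) ?\<pi> ` P)"
  proof -
    have "{?\<pi> ` X |X. X \<in> P \<and> X \<subseteq> carrier G} = (`) ?\<pi> ` P" using PG by blast
    then show ?thesis by (simp add: quotient_sring_def basic)
  qed
  have quotS: "quotient_sring G A U L = int_span ((`) ?\<pi> ` ?PU)"
  proof -
    have "{?\<pi> ` X |X. X \<in> P \<and> X \<subseteq> U} = (`) ?\<pi> ` ?PU" by blast
    then show ?thesis by (simp add: quotient_sring_def basic)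
  qed
  have S: "S = ?U Mod L" by (simp add: S_def section_group_def)
  have carS: "carrier S = ?\<pi> ` U" unfolding S by (simp add: carrier_FactGroup)
  have carSM: "carrier S \<subseteq> carrier ?M"
    unfolding carS carrier_FactGroup using U.subset by blast
  have AutS: "\<rho> \<in> AutS \<longleftrightarrow> \<rho> \<in> auto (?U Mod L) \<and> (\<forall>B\<in>(`) ?\<pi> ` ?PU. \<rho> ` B = B)" for \<rho>
    unfolding AutS_def S quotS by (rule S.Aut_grp_sring_iff[OF finS partS])
  \<comment> \<open>That \<open>\<tau> C\<close> stays in the section is recorded because a map from
    \<open>AutGL\<close> can be evaluated only there.\<close>
  have AutU: "\<exists>\<tau>1. \<tau>1 \<in> auto ?U \<and> (\<forall>X\<in>P. X \<subseteq> U \<longrightarrow> \<tau>1 ` X = X) \<and>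
      (\<forall>C\<in>carrier S. \<tau> C = \<tau>1 ` C \<and> \<tau> C \<in> carrier S)" if \<tau>: "\<tau> \<in> AutU" for \<tau>
  proof -
    have sg: "section_group ?U U L = S" by (simp add: S section_group_def)
    obtain \<tau>1 where "\<tau> = (\<lambda>C\<in>carrier S. \<tau>1 ` C)" "\<tau>1 \<in> Aut_grp_sring ?U (int_span ?PU)"
      "(\<lambda>C. \<tau>1 ` C) ` carrier S = carrier S"
      using \<tau> unfolding AutU_def section_perms_def subU sg by blast
    then show ?thesis
      unfolding GU.Aut_grp_sring_iff[OF finU partU] by (intro exI[of _ \<tau>1]) auto
  qed
  have AutGL: "\<exists>\<tau>2. \<tau>2 \<in> auto ?M \<and> (\<forall>X\<in>P. \<tau>2 ` ?\<pi> ` X = ?\<pi> ` X) \<and>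
      (\<forall>C\<in>carrier S. \<tau> C = \<tau>2 C)" if \<tau>: "\<tau> \<in> AutGL" for \<tau>
  proof -
    obtain \<tau>2 where "\<tau> = restrict \<tau>2 (carrier S)" "\<tau>2 \<in> Aut_grp_sring ?M (int_span ((`) ?\<pi> ` P))"
      using \<tau> unfolding AutGL_def subgroup_perms_def quotM by blast
    then show ?thesis
      unfolding M.Aut_grp_sring_iff[OF finM partM] by (intro exI[of _ \<tau>2]) auto
  qed
  \<comment> \<open>The identity of \<open>auto\<close> is the restricted one, so its effect on sets
    has to be stated for subsets of the carrier.\<close>
  have idU: "(\<lambda>x\<in>U. x) ` X = X" if "X \<subseteq> U" for X
    using that by (auto simp: image_iff subset_iff)
  have idM: "(\<lambda>C\<in>carrier ?M. C) ` B = B" if "B \<subseteq> carrier ?M" for B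
    using that by (auto simp: image_iff subset_iff)
  have ci: "ci_sring G A"
    if fac: "\<And>\<rho>. \<rho> \<in> AutS \<Longrightarrow>
      \<exists>\<tau>1 \<tau>2. \<tau>1 \<in> auto ?U \<and> (\<forall>X\<in>P. X \<subseteq> U \<longrightarrow> \<tau>1 ` X = X) \<and>
        \<tau>2 \<in> auto ?M \<and> (\<forall>X\<in>P. \<tau>2 ` ?\<pi> ` X = ?\<pi> ` X) \<and>
        (\<forall>C\<in>carrier S. \<rho> C = \<tau>2 (\<tau>1 ` C))"
    unfolding A ci_sring_iff[OF fin P]
  proof (intro allI impI, elim conjE)
    fix f assume f: "cayley_iso G P f" and P': "s_partition G ((`) f ` P)"
    have fb: "bij_betw f (carrier G) (carrier G)" using f by (simp add: cayley_iso_def)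
    have card: "card (f ` W) = card W" if "W \<subseteq> carrier G" for W
      using fb that by (metis bij_betw_def card_image inj_on_subset)
    obtain \<theta> where \<theta>: "\<theta> \<in> auto G" "\<theta> ` f ` L = L" "\<theta> ` f ` U = U"
      using exists_auto_mapping_flag[OF cayley_iso_image_subgroup[OF f L LP]
          cayley_iso_image_subgroup[OF f U UP] image_mono[OF LU] L U LU
          card[OF L.subset] card[OF U.subset]] .
    obtain \<theta>' where \<theta>': "\<theta>' \<in> auto G" "\<And>x. x \<in> carrier G \<Longrightarrow> \<theta>' (\<theta> x) = x"
      "\<And>x. x \<in> carrier G \<Longrightarrow> \<theta> (\<theta>' x) = x"
      using auto_inverse[OF \<theta>(1)] by blast
    have \<theta>f: "cayley_iso G P (\<theta> \<circ> f)" by (rule cayley_iso_auto_compose[OF f PG \<theta>(1)])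
    have \<theta>P: "s_partition G ((`) (\<theta> \<circ> f) ` P)"
      using s_partition_auto_image[OF fin P' \<theta>(1)] by (simp add: image_image image_comp)
    have "\<exists>\<sigma>\<in>auto G. \<forall>X\<in>P. (\<theta> \<circ> f) ` X = \<sigma> ` X"
    \<comment> \<open>The criterion is applied to \<open>\<theta> \<circ> f\<close>, which preserves
      \<open>U\<close> and \<open>L\<close>, while the S-ring \<open>A\<close> on the source side is
      unchanged.\<close>
    proof (rule wreath_iso_block_auto[OF P L U LU LP UP _ \<theta>f \<theta>P])
      show "L <#> X = X" if X: "X \<in> P" "\<not> X \<subseteq> U" for X
      proof
        have rad: "L \<subseteq> rad G X"
          using assms(8) X basic by (auto simp: nontrivial_wreath_product_def wreath_product_def)
        show "L <#> X \<subseteq> X"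
        proof
          fix y assume "y \<in> L <#> X"
          then obtain l x where l: "l \<in> L" "x \<in> X" "y = l \<otimes> x" by (auto simp: set_mult_def)
          then have "y \<in> l <# X" by (auto simp: l_coset_def)
          moreover have "l <# X = X" using rad l by (auto simp: rad_def)
          ultimately show "y \<in> X" by simp
        qed
        show "X \<subseteq> L <#> X" by (rule subset_set_mult_right[OF L.one_closed PG[OF X(1)]])
      qed
      show "(\<theta> \<circ> f) ` U = U" "(\<theta> \<circ> f) ` L = L" unfolding image_comp[symmetric] by (fact \<theta>)+
      show "ci_sring ?U (int_span ?PU)" using assms(9) subU by simp
      show "ci_sring ?M (int_span ((`) ?\<pi> ` P))" using assms(10) quotM by simp
    next
      fix \<rho> assume \<rho>: "\<rho> \<in> auto (?U Mod L)"
        "\<And>X. X \<in> P \<Longrightarrow> X \<subseteq> U \<Longrightarrow> \<rho> ` ?\<pi> ` X = ?\<pi> ` X"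
      have "\<rho> \<in> AutS" unfolding AutS using \<rho> by blast
      then show "\<exists>\<tau>1 \<tau>2. \<tau>1 \<in> auto ?U \<and> (\<forall>X\<in>P. X \<subseteq> U \<longrightarrow> \<tau>1 ` X = X) \<and>
        \<tau>2 \<in> auto ?M \<and> (\<forall>X\<in>P. \<tau>2 ` ?\<pi> ` X = ?\<pi> ` X) \<and>
        (\<forall>u\<in>U. \<rho> (?\<pi> u) = \<tau>2 (\<tau>1 ` ?\<pi> u))"
        using fac[of \<rho>] unfolding carS ball_simps by blast
    qed
    then obtain \<sigma> where \<sigma>: "\<sigma> \<in> auto G" and \<sigma>X: "\<forall>X\<in>P. (\<theta> \<circ> f) ` X = \<sigma> ` X"
      by (elim bexE)
    \<comment> \<open>Undoing \<open>\<theta>\<close> turns the automorphism found for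
      \<open>\<theta> \<circ> f\<close> into one for \<open>f\<close>.\<close>
    let ?s = "compose (carrier G) \<theta>' \<sigma>"
    have "f ` X = ?s ` X" if X: "X \<in> P" for X
    proof -
      note XG = PG[OF X]
      have "?s ` X = \<theta>' ` \<sigma> ` X"
        unfolding image_image using XG by (intro image_cong refl) (auto simp: compose_def)
      also have "\<dots> = \<theta>' ` \<theta> ` f ` X" unfolding bspec[OF \<sigma>X X, symmetric] image_comp ..
      also have "\<dots> = (\<lambda>x. x) ` f ` X"
        unfolding image_image using XG bij_betwE[OF fb] by (intro image_cong refl \<theta>'(2)) blast
      finally show ?thesis by simp
    qed
    then show "\<exists>\<sigma>\<in>auto G. \<forall>X\<in>P. f ` X = \<sigma> ` X"
      using auto_compose[OF \<theta>'(1) \<sigma>] by blast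
  qed
  show ?thesis
  proof (intro conjI impI ci)
    fix \<rho> assume eq: "AutS = perm_prod (carrier S) AutU AutGL" and "\<rho> \<in> AutS"
    \<comment> \<open>The left factor of \<open>perm_prod\<close> acts first, which matches the
      order \<open>\<tau>1\<close>, then \<open>\<tau>2\<close>.\<close>
    then obtain \<alpha> \<beta> where \<rho>: "\<rho> = compose (carrier S) \<beta> \<alpha>" and "\<alpha> \<in> AutU" "\<beta> \<in> AutGL"
      by (auto simp: perm_prod_def)
    obtain \<tau>1 where \<tau>1: "\<tau>1 \<in> auto ?U" "\<forall>X\<in>P. X \<subseteq> U \<longrightarrow> \<tau>1 ` X = X"
      "\<forall>C\<in>carrier S. \<alpha> C = \<tau>1 ` C \<and> \<alpha> C \<in> carrier S"
      using AutU[OF \<open>\<alpha> \<in> AutU\<close>] by (elim exE conjE)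
    obtain \<tau>2 where \<tau>2: "\<tau>2 \<in> auto ?M" "\<forall>X\<in>P. \<tau>2 ` ?\<pi> ` X = ?\<pi> ` X"
      "\<forall>C\<in>carrier S. \<beta> C = \<tau>2 C"
      using AutGL[OF \<open>\<beta> \<in> AutGL\<close>] by (elim exE conjE)
    have "\<forall>C\<in>carrier S. \<rho> C = \<tau>2 (\<tau>1 ` C)"
    proof
      fix C assume C: "C \<in> carrier S"
      have "\<rho> C = \<beta> (\<alpha> C)" using C by (simp add: \<rho> compose_eq)
      also have "\<dots> = \<tau>2 (\<alpha> C)" by (rule bspec[OF \<tau>2(3) conjunct2[OF bspec[OF \<tau>1(3) C]]])
      finally show "\<rho> C = \<tau>2 (\<tau>1 ` C)" using bspec[OF \<tau>1(3) C] by simp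
    qed
    then show "\<exists>\<tau>1 \<tau>2. \<tau>1 \<in> auto ?U \<and> (\<forall>X\<in>P. X \<subseteq> U \<longrightarrow> \<tau>1 ` X = X) \<and>
        \<tau>2 \<in> auto ?M \<and> (\<forall>X\<in>P. \<tau>2 ` ?\<pi> ` X = ?\<pi> ` X) \<and>
        (\<forall>C\<in>carrier S. \<rho> C = \<tau>2 (\<tau>1 ` C))"
      using \<tau>1(1,2) \<tau>2(1,2) by (intro exI conjI)
  next
    fix \<rho> assume "AutS = AutU" and "\<rho> \<in> AutS"
    then have "\<rho> \<in> AutU" by simp
    obtain \<tau>1 where \<tau>1: "\<tau>1 \<in> auto ?U" "\<forall>X\<in>P. X \<subseteq> U \<longrightarrow> \<tau>1 ` X = X"
      "\<forall>C\<in>carrier S. \<rho> C = \<tau>1 ` C \<and> \<rho> C \<in> carrier S"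
      using AutU[OF \<open>\<rho> \<in> AutU\<close>] by (elim exE conjE)
    let ?\<tau>2 = "\<lambda>C\<in>carrier ?M. C"
    have "\<forall>C\<in>carrier S. \<rho> C = ?\<tau>2 (\<tau>1 ` C)"
    proof
      fix C assume C: "C \<in> carrier S"
      have "\<rho> C \<in> carrier ?M" using bspec[OF \<tau>1(3) C] carSM by blast
      then have "\<rho> C = ?\<tau>2 (\<rho> C)" by simp
      also have "\<rho> C = \<tau>1 ` C" by (rule conjunct1[OF bspec[OF \<tau>1(3) C]])
      finally show "\<rho> C = ?\<tau>2 (\<tau>1 ` C)" using bspec[OF \<tau>1(3) C] by simp
    qed
    moreover have "\<forall>X\<in>P. ?\<tau>2 ` ?\<pi> ` X = ?\<pi> ` X"
    proof
      fix X assume "X \<in> P"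
      then show "?\<tau>2 ` ?\<pi> ` X = ?\<pi> ` X"
        using PG unfolding carrier_FactGroup by (intro idM[unfolded carrier_FactGroup] image_mono)
    qed
    ultimately show "\<exists>\<tau>1 \<tau>2. \<tau>1 \<in> auto ?U \<and> (\<forall>X\<in>P. X \<subseteq> U \<longrightarrow> \<tau>1 ` X = X) \<and>
        \<tau>2 \<in> auto ?M \<and> (\<forall>X\<in>P. \<tau>2 ` ?\<pi> ` X = ?\<pi> ` X) \<and>
        (\<forall>C\<in>carrier S. \<rho> C = \<tau>2 (\<tau>1 ` C))"
      using \<tau>1(1,2) M.id_in_auto by (intro exI conjI)
  next
    fix \<rho> assume "AutS = AutGL" and "\<rho> \<in> AutS"
    then have "\<rho> \<in> AutGL" by simp
    obtain \<tau>2 where \<tau>2: "\<tau>2 \<in> auto ?M" "\<forall>X\<in>P. \<tau>2 ` ?\<pi> ` X = ?\<pi> ` X"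
      "\<forall>C\<in>carrier S. \<rho> C = \<tau>2 C"
      using AutGL[OF \<open>\<rho> \<in> AutGL\<close>] by (elim exE conjE)
    \<comment> \<open>Cosets in the section are subsets of \<open>U\<close>, as
      \<open>L \<subseteq> U\<close>, so the restricted identity maps each of them onto
      itself.\<close>
    let ?\<tau>1 = "\<lambda>x\<in>U. x"
    have "?\<tau>1 \<in> auto ?U" using GU.id_in_auto by simp
    moreover have "\<forall>X\<in>P. X \<subseteq> U \<longrightarrow> ?\<tau>1 ` X = X" using idU by blast
    moreover have "\<forall>C\<in>carrier S. \<rho> C = \<tau>2 (?\<tau>1 ` C)"
    proof
      fix C assume C: "C \<in> carrier S"
      then have "C \<subseteq> U" unfolding carS using LU by (auto simp: r_coset_def)
      then show "\<rho> C = \<tau>2 (?\<tau>1 ` C)" using bspec[OF \<tau>2(3) C] idU by simp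
    qed
    ultimately show "\<exists>\<tau>1 \<tau>2. \<tau>1 \<in> auto ?U \<and> (\<forall>X\<in>P. X \<subseteq> U \<longrightarrow> \<tau>1 ` X = X) \<and>
        \<tau>2 \<in> auto ?M \<and> (\<forall>X\<in>P. \<tau>2 ` ?\<pi> ` X = ?\<pi> ` X) \<and>
        (\<forall>C\<in>carrier S. \<rho> C = \<tau>2 (\<tau>1 ` C))"
      using \<tau>2(1,2) by (intro exI conjI)
  qed
qed

end
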